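(* Let $g$ be a $g$-function on a finite alphabet $A$, with context tree $\tau^g$, and suppose that $g\ge\epsilon$ for some $\epsilon>0$. If $\overline{gr}(\tau^g)<[1-(|A|-1)\epsilon]^{-1}$, then there exists a unique stationary measure compatible with $g$ (that is, $\mathcal{M}_T(g)$ has exactly one element), and it is weak-Bernoulli.
   Context: $A$ is a finite (nonempty) alphabet with the discrete topology, $\mathcal{X}=A^{\mathbb{Z}}$, $\mathcal{X}^-=A^{\{\ldots,-2,-1\}}$ (pasts), $\mathcal{X}^{\le 0}=A^{\{\ldots,-1,0\}}$, all with product topologies; $\mathcal{F}^{\le 0}$, $\mathcal{F}^-$ and $\mathcal{F}^{\ge n}$ are the $\sigma$-algebras generated by the coordinates of index $\le 0$, $\le -1$ and $\ge n$. For $x\in\mathcal{X}$, $\underline x=\ldots x_{-2}x_{-1}$. $T$ is the shift $(Tx)_n=x_{n+1}$, and $[a]_0=\{x: x_0=a\}$. A $g$-function is an $\mathcal{F}^{\le 0}$-measurable $g:\mathcal{X}^{\le 0}\to[0,1]$ with $\sum_{a\in A}g(\underline x a)=1$ for all $\underline x\in\mathcal{X}^-$, where $\underline x a$ is concatenation. The context length function is $\ell^g(\underline x)=\inf\{k\ge1: g(\underline y x_{-k}^{-1}a)=g(\underline z x_{-k}^{-1}a)\ \text{for all } a\in A,\ \underline y,\underline z\in\mathcal{X}^-\}$, with $\inf\emptyset=\infty$. The context tree is $\tau^g=\bigcup_{\underline x\in\mathcal{X}^-}\{x_{-\ell^g(\underline x)}^{-1}\}$. For $\tau=\tau^g$,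 let $\tau^n=\{y_{-n}^{-1}:\underline y\in\mathcal{X}^-,\ \ell^g(\underline y)>n\}\subset A^n$; the upper exponential growth of $\tau$ is $\overline{gr}(\tau)=\limsup_{n\to\infty}|\tau^n|^{1/n}$. $\mathcal{M}_T(g)$ is the set of shift-invariant Borel probability measures $\mu$ on $\mathcal{X}$ compatible with $g$, i.e. such that for every $a\in A$, $\mathbb{E}_\mu(\mathbf 1_{[a]_0}\mid\mathcal{F}^-)(x)=g(\underline x a)$ for $\mu$-a.e. $x$. A stationary (shift-invariant) measure $\mu$ is weak-Bernoulli (equivalently absolutely regular, or $\beta$-mixing) if $\beta(n)\to0$ as $n\to\infty$, where $\beta(n)=\sup\frac12\sum_{i=1}^I\sum_{j=1}^J|\mu(A_i\cap B_j)-\mu(A_i)\mu(B_j)|$, the supremum being over all finite partitions $\{A_1,\ldots,A_I\}$ and $\{B_1,\ldots,B_J\}$ of $\mathcal{X}$ with $A_i\in\mathcal{F}^{\le0}$ and $B_j\in\mathcal{F}^{\ge n}$. *)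

theory Defs
  imports "HOL-Probability.Probability"
begin

text \<open>
  The alphabet is a type \<open>'a :: finite\<close>. For a set \<open>I\<close> of indices, sequences indexed by \<open>I\<close> are the
  extensional functions in \<open>I \<rightarrow>\<^sub>E UNIV\<close>, which is the space of the product measurable space
  below. Since the alphabet is finite and discrete and \<open>I\<close> is countable, its \<open>\<sigma>\<close>-algebra is both
  the one generated by the coordinates and the Borel one of the product topology.
\<close>

definition seqs :: "int set \<Rightarrow> (int \<Rightarrow> 'a::finite) measure" where
  "seqs I = PiM I (\<lambda>_. count_space UNIV)"

abbreviation pasts :: "(int \<Rightarrow> 'a::finite) set" where
  "pasts \<equiv> space (seqs {..-1})"

definition coord_algebra :: "int set \<Rightarrow> (int \<Rightarrow> 'a::finite) measure" where
  "coord_algebra I = sigma UNIV {(\<lambda>x. x i) -` B | i B. i \<in> I}"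

definition shift :: "(int \<Rightarrow> 'a) \<Rightarrow> int \<Rightarrow> 'a" where
  "shift x = (\<lambda>n. x (n + 1))"

definition past :: "(int \<Rightarrow> 'a) \<Rightarrow> int \<Rightarrow> 'a" where
  "past x = restrict x {..-1}"

text \<open>For a past \<open>x\<close> and a letter \<open>a\<close>, the concatenation \<open>xa\<close>, with \<open>a\<close> in position \<open>0\<close>, is
  \<open>x(0 := a)\<close>.\<close>

definition g_function :: "((int \<Rightarrow> 'a::finite) \<Rightarrow> real) \<Rightarrow> bool" where
  "g_function g \<longleftrightarrow>
     g \<in> borel_measurable (seqs {..0}) \<and>
     (\<forall>z\<in>space (seqs {..0}). g z \<in> {0..1}) \<and>
     (\<forall>x\<in>pasts. (\<Sum>a\<in>UNIV. g (x(0 := a))) = 1)"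

text \<open>\<open>append_suffix y k x\<close> is the past \<open>\<dots> y\<^sub>-\<^sub>2 y\<^sub>-\<^sub>1 x\<^sub>-\<^sub>k \<dots> x\<^sub>-\<^sub>1\<close>, in which \<open>y\<close> is moved
  \<open>k\<close> places to the left.\<close>

definition append_suffix :: "(int \<Rightarrow> 'a) \<Rightarrow> nat \<Rightarrow> (int \<Rightarrow> 'a) \<Rightarrow> int \<Rightarrow> 'a" where
  "append_suffix y k x = (\<lambda>i\<in>{..-1}. if - int k \<le> i then x i else y (i + int k))"

text \<open>In \<^typ>\<open>enat\<close> the infimum of the empty set is \<open>\<infinity>\<close>.\<close>

definition context_length :: "((int \<Rightarrow> 'a::finite) \<Rightarrow> real) \<Rightarrow> (int \<Rightarrow> 'a) \<Rightarrow> enat" where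
  "context_length g x = Inf {enat k | k. k \<ge> 1 \<and>
     (\<forall>a. \<forall>y\<in>pasts. \<forall>z\<in>pasts.
        g ((append_suffix y k x)(0 := a)) = g ((append_suffix z k x)(0 := a)))}"

text \<open>The words \<open>y\<^sub>-\<^sub>n \<dots> y\<^sub>-\<^sub>1\<close> of length \<open>n\<close> that are proper suffixes of contexts.\<close>

definition context_tree_level :: "((int \<Rightarrow> 'a::finite) \<Rightarrow> real) \<Rightarrow> nat \<Rightarrow> 'a list set" where
  "context_tree_level g n =
     {map y [- int n..-1] | y. y \<in> pasts \<and> context_length g y > enat n}"

definition upper_growth :: "((int \<Rightarrow> 'a::finite) \<Rightarrow> real) \<Rightarrow> ereal" where
  "upper_growth g = limsup (\<lambda>n. ereal (root n (real (card (context_tree_level g n)))))"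

definition invariant_compatible ::
    "((int \<Rightarrow> 'a::finite) \<Rightarrow> real) \<Rightarrow> (int \<Rightarrow> 'a) measure set" where
  "invariant_compatible g = {\<mu>.
     prob_space \<mu> \<and> sets \<mu> = sets (seqs UNIV) \<and>
     distr \<mu> \<mu> shift = \<mu> \<and>
     (\<forall>a. AE x in \<mu>.
        real_cond_exp \<mu> (coord_algebra {..-1}) (indicator {x. x 0 = a}) x = g ((past x)(0 := a)))}"

text \<open>The parts of \<^const>\<open>partition_on\<close> are nonempty; empty parts would contribute nothing to
  the sum. For a probability measure the supremum is over a set bounded by \<open>1\<close>.\<close>

definition beta_mixing_coeff :: "(int \<Rightarrow> 'a::finite) measure \<Rightarrow> nat \<Rightarrow> real" where
  "beta_mixing_coeff \<mu> n =
     Sup {1/2 * (\<Sum>A\<in>P. \<Sum>B\<in>Q. \<bar>measure \<mu> (A \<inter> B) - measure \<mu> A * measure \<mu> B\<bar>) | P Q.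
        finite P \<and> partition_on UNIV P \<and> P \<subseteq> sets (coord_algebra {..0}) \<and>
        finite Q \<and> partition_on UNIV Q \<and> Q \<subseteq> sets (coord_algebra {int n..})}"

definition weak_Bernoulli :: "(int \<Rightarrow> 'a::finite) measure \<Rightarrow> bool" where
  "weak_Bernoulli \<mu> \<longleftrightarrow> beta_mixing_coeff \<mu> \<longlonglongrightarrow> 0"

end

theory Submission
  imports Defs
begin

text \<open>
  Let \<open>M = 1 - (|A| - 1) \<epsilon>\<close>. Since \<open>g \<ge> \<epsilon>\<close>, no value of \<open>g\<close> exceeds \<open>M\<close>, so a fixed word of
  length \<open>n\<close> has probability at most \<open>M\<^sup>n\<close> whatever came before it. The growth condition says that
  \<open>\<Sum>n. |\<tau>\<^sup>n| M\<^sup>n\<close> converges. Hence the probability that the last \<open>n\<close> letters do not determine the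
  law of the next one is summable in \<open>n\<close>, uniformly in the past.

  This gives a coupling of the chains started from two arbitrary pasts. First let both chains follow
  the same uniformly chosen word of length \<open>N\<close>, which has probability at least \<open>(|A| \<epsilon>)\<^sup>N\<close>. As long
  as the chains agree, they can be kept together unless the common word, of length \<open>n\<close>, is in \<open>\<tau>\<^sup>n\<close>, and by
  summability they never separate with probability at least some \<open>\<delta> > 0\<close> that does not depend on the
  pasts (\<open>synchro_positive\<close>). If they separate, one tries again: late separations are improbable, and
  after early ones there is enough time left. So the total variation distance of the laws after a
  gap of length \<open>m\<close> tends to \<open>0\<close> as \<open>m\<close> grows, uniformly in the two pasts and in the length of the
  block observed after the gap (\<open>uniform_forgetting\<close>).

  The rest follows from this uniform loss of memory.
  \<^item> The word probabilities of the chain converge to limits \<open>freq\<close>, and Kolmogorov's extension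
    theorem makes these the word frequencies of a bi-infinite process (\<open>exists_has_freq\<close>). It is
    stationary, and compatible with \<open>g\<close>: up to an event of vanishing probability, \<open>g\<close> is a
    function of finitely many letters, although it may be discontinuous.
  \<^item> Under a compatible stationary measure, the letters after time \<open>0\<close> evolve like the chain, given
    the past. Averaging the loss of memory over the past shows that an event \<open>A\<close> of the past and a
    later block decouple up to a small multiple of the probability of \<open>A\<close> (\<open>decoupling\<close>). With
    \<open>A\<close> trivial, the word frequencies must be \<open>freq\<close>, which is uniqueness. With general \<open>A\<close>, summing
    over partitions, the measure is weak-Bernoulli.
\<close>

section \<open>Words and chains with complete connections\<close>

definition words :: "nat \<Rightarrow> 'a::finite list set" where
  "words n = {w. length w = n}"

lemma finite_words [simp]: "finite (words n)"
  using finite_lists_length_eq[of "UNIV :: 'a set" n] by (simp add: words_def)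

lemma in_words: "w \<in> words (length w)"
  by (simp add: words_def)

lemma words_0 [simp]: "words 0 = {[]}"
  by (auto simp: words_def)

lemma sum_words_append:
  "(\<Sum>w\<in>words (m + n). f w) = (\<Sum>u\<in>words n. \<Sum>v\<in>words m. f (v @ u))"
proof -
  have "(\<Sum>u\<in>words n. \<Sum>v\<in>words m. f (v @ u)) = (\<Sum>(u,v)\<in>words n \<times> words m. f (v @ u))"
    by (simp add: sum.cartesian_product)
  also have "\<dots> = (\<Sum>w\<in>words (m + n). f w)"
    by (rule sum.reindex_bij_witness[of _ "\<lambda>w. (drop m w, take m w)" "\<lambda>(u, v). v @ u"])
       (auto simp: words_def)
  finally show ?thesis by simp
qed

lemma sum_words_1: "(\<Sum>w\<in>words (Suc 0). f w) = (\<Sum>a\<in>UNIV. f [a])"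
  by (rule sum.reindex_bij_witness[of _ "\<lambda>a. [a]" hd]) (auto simp: words_def length_Suc_conv)

lemma sum_words_Suc: "(\<Sum>w\<in>words (Suc n). f w) = (\<Sum>w\<in>words n. \<Sum>a\<in>UNIV. f (a # w))"
  using sum_words_append[of f 1 n] by (simp add: sum_words_1)

lemma sum_words_Suc_right: "(\<Sum>w\<in>words (Suc n). f w) = (\<Sum>a\<in>UNIV. \<Sum>w\<in>words n. f (w @ [a]))"
  using sum_words_append[of f n 1] by (simp add: sum_words_1)

text \<open>Words after which the law of the next letter still depends on the more remote past. Since words
  are written newest letter first, these are, for \<open>n \<ge> 1\<close>, the words in \<open>\<tau>\<^sup>n\<close> read backwards.\<close>

definition undetermined :: "('a::finite stream \<Rightarrow> 'a \<Rightarrow> real) \<Rightarrow> nat \<Rightarrow> 'a list set" where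
  "undetermined G n = {w \<in> words n. \<exists>s t a. G (w @- s) a \<noteq> G (w @- t) a}"

text \<open>A past is a stream whose head is the most recent letter, so that a step of the process is \<open>##\<close>
  and a finite word of recent letters is put in front of a past by \<open>@-\<close>. The constant \<open>M\<close>
  bounds the values of \<open>G\<close>, because the other letters take up at least \<open>(|A| - 1) \<epsilon>\<close>. The growth
  condition on the context tree enters as the summability condition: a given word of length \<open>n\<close>
  appears with probability at most \<open>M\<^sup>n\<close>, so the probability of seeing an undetermined word of length \<open>n\<close> is summable in \<open>n\<close>.\<close>

locale chain =
  fixes G :: "'a::finite stream \<Rightarrow> 'a \<Rightarrow> real" and \<epsilon> M :: real
  assumes eps_pos: "\<epsilon> > 0"
    and G_ge: "\<And>s a. \<epsilon> \<le> G s a"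
    and G_sum: "\<And>s. (\<Sum>a\<in>UNIV. G s a) = 1"
    and M_def: "M = 1 - (real CARD('a) - 1) * \<epsilon>"
    and G_measurable [measurable]: "\<And>a. (\<lambda>s. G s a) \<in> borel_measurable (stream_space (count_space UNIV))"
    and summable_undetermined: "summable (\<lambda>n. real (card (undetermined G n)) * M ^ n)"
begin

lemma G_nonneg: "0 \<le> G s a"
  using eps_pos G_ge[of s a] by linarith

lemma G_abs: "\<bar>G s a\<bar> \<le> 1"
  using member_le_sum[of a UNIV "G s"] G_sum[of s] G_nonneg[of s] by simp

lemma G_le: "G s a \<le> M"
proof -
  have "(\<Sum>b\<in>UNIV - {a}. \<epsilon>) \<le> (\<Sum>b\<in>UNIV - {a}. G s b)"
    by (rule sum_mono) (rule G_ge)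
  moreover have "(\<Sum>b\<in>UNIV. G s b) = G s a + (\<Sum>b\<in>UNIV - {a}. G s b)"
    by (rule sum.remove) auto
  moreover have "real (card (UNIV - {a})) = real CARD('a) - 1"
    by (simp add: card_Diff_singleton of_nat_diff Suc_leI)
  ultimately show ?thesis
    using G_sum[of s] by (simp add: M_def)
qed

lemma eps_le_M: "\<epsilon> \<le> M"
  using G_ge G_le order_trans by blast

lemma M_pos: "0 < M"
  using eps_pos eps_le_M by linarith

lemma card_M_ge_1: "1 \<le> real CARD('a) * M"
proof -
  have "(\<Sum>a\<in>UNIV. G (sconst undefined) a) \<le> (\<Sum>a\<in>(UNIV::'a set). M)"
    by (rule sum_mono) (rule G_le)
  then show ?thesis using G_sum by simp
qed

fun word_prob :: "'a stream \<Rightarrow> 'a list \<Rightarrow> real" where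
  "word_prob s [] = 1"
| "word_prob s (a # w) = word_prob s w * G (w @- s) a"

lemma word_prob_append: "word_prob s (v @ u) = word_prob s u * word_prob (u @- s) v"
  by (induction v) (auto simp: mult.assoc)

lemma word_prob_nonneg: "0 \<le> word_prob s w"
  by (induction w) (auto simp: G_nonneg)

lemma word_prob_le: "word_prob s w \<le> M ^ length w"
proof (induction w)
  case (Cons a w)
  then have "word_prob s w * G (w @- s) a \<le> M ^ length w * M"
    using M_pos by (intro mult_mono G_le G_nonneg) auto
  then show ?case by (simp add: mult.commute)
qed simp

lemma sum_word_prob: "(\<Sum>w\<in>words n. word_prob s w) = 1"
  by (induction n) (simp_all add: sum_words_Suc sum_distrib_left[symmetric] G_sum)

definition expect :: "nat \<Rightarrow> 'a stream \<Rightarrow> ('a list \<Rightarrow> real) \<Rightarrow> real" where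
  "expect n s f = (\<Sum>w\<in>words n. word_prob s w * f w)"

lemma expect_0 [simp]: "expect 0 s f = f []"
  by (simp add: expect_def)

lemma expect_add: "expect (m + n) s f = expect n s (\<lambda>u. expect m (u @- s) (\<lambda>v. f (v @ u)))"
  by (simp add: expect_def sum_words_append word_prob_append sum_distrib_left mult.assoc)

lemma expect_Suc_right: "expect (Suc n) s f = (\<Sum>a\<in>UNIV. G s a * expect n (a ## s) (\<lambda>v. f (v @ [a])))"
  by (simp add: expect_def sum_words_Suc_right word_prob_append sum_distrib_left mult.assoc)

lemma expect_cong: "(\<And>w. length w = n \<Longrightarrow> f w = f' w) \<Longrightarrow> expect n s f = expect n s f'"
  by (simp add: expect_def words_def)

lemma expect_const [simp]: "expect n s (\<lambda>_. c) = c"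
  using sum_word_prob[of s n] by (simp add: expect_def sum_distrib_right[symmetric])

lemma expect_mono: "(\<And>w. length w = n \<Longrightarrow> f w \<le> f' w) \<Longrightarrow> expect n s f \<le> expect n s f'"
  by (auto simp: expect_def words_def intro!: sum_mono mult_left_mono word_prob_nonneg)

lemma expect_sum: "expect n s (\<lambda>w. \<Sum>i\<in>I. f i w) = (\<Sum>i\<in>I. expect n s (f i))"
  unfolding expect_def sum_distrib_left by (rule sum.swap)

lemma expect_diff: "expect n s (\<lambda>w. f w - f' w) = expect n s f - expect n s f'"
  by (simp add: expect_def algebra_simps sum_subtractf)

section \<open>Coupling two pasts\<close>

text \<open>Two laws \<open>p\<close> and \<open>q\<close> share the part \<open>h\<close>, on which the integrands are compared letter by
  letter. The parts left over have the same total mass, so there only the worst case \<open>b\<close> counts.\<close>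

lemma one_step_coupling:
  fixes p q h X Y :: "'a \<Rightarrow> real"
  assumes "sum p UNIV = 1" "sum q UNIV = 1"
    and "\<And>a. h a \<le> p a" "\<And>a. h a \<le> q a"
    and b: "\<And>a a'. X a - Y a' \<le> b"
  shows "(\<Sum>a\<in>UNIV. p a * X a) - (\<Sum>a\<in>UNIV. q a * Y a)
    \<le> (\<Sum>a\<in>UNIV. h a * (X a - Y a)) + b * (1 - sum h UNIV)"
proof -
  define y where "y = Min (range Y)"
  have y: "y \<le> Y a" for a
    by (simp add: y_def)
  have "y \<in> range Y"
    unfolding y_def by (rule Min_in) auto
  then have X: "X a \<le> b + y" for a
    using b[of a] by (auto simp: algebra_simps)
  have "(\<Sum>a\<in>UNIV. (p a - h a) * X a) \<le> (\<Sum>a\<in>UNIV. (p a - h a) * (b + y))"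
    using assms(3) X by (intro sum_mono mult_left_mono) auto
  also have "\<dots> = (1 - sum h UNIV) * (b + y)"
    using assms(1) by (simp add: sum_distrib_right[symmetric] sum_subtractf)
  finally have 1: "(\<Sum>a\<in>UNIV. p a * X a) - (\<Sum>a\<in>UNIV. h a * X a) \<le> (1 - sum h UNIV) * (b + y)"
    by (simp add: left_diff_distrib sum_subtractf)
  have "(\<Sum>a\<in>UNIV. (q a - h a) * y) \<le> (\<Sum>a\<in>UNIV. (q a - h a) * Y a)"
    using assms(4) y by (intro sum_mono mult_left_mono) auto
  moreover have "(\<Sum>a\<in>UNIV. (q a - h a) * y) = (1 - sum h UNIV) * y"
    using assms(2) by (simp add: sum_distrib_right[symmetric] sum_subtractf)
  ultimately have 2: "(1 - sum h UNIV) * y \<le> (\<Sum>a\<in>UNIV. q a * Y a) - (\<Sum>a\<in>UNIV. h a * Y a)"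
    by (simp add: left_diff_distrib sum_subtractf)
  show ?thesis
    using 1 2 by (simp add: algebra_simps sum_subtractf)
qed

text \<open>If \<open>h w a\<close> is a common lower bound of the two transition probabilities after the common word
  \<open>w\<close>, then \<open>weight h w\<close> is the probability that two coupled copies, started from different
  pasts, both produce \<open>w\<close> without having separated.\<close>

fun weight :: "('a list \<Rightarrow> 'a \<Rightarrow> real) \<Rightarrow> 'a list \<Rightarrow> real" where
  "weight h [] = 1"
| "weight h (a # w) = weight h w * h w a"

definition mass :: "('a list \<Rightarrow> 'a \<Rightarrow> real) \<Rightarrow> nat \<Rightarrow> real" where
  "mass h k = (\<Sum>w\<in>words k. weight h w)"

lemma mass_step: "mass h k - mass h (Suc k) = (\<Sum>w\<in>words k. weight h w * (1 - (\<Sum>a\<in>UNIV. h w a)))"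
  by (simp add: mass_def sum_words_Suc sum_distrib_left[symmetric] right_diff_distrib sum_subtractf)

lemma weight_nonneg: "(\<And>w a. 0 \<le> h w a) \<Longrightarrow> 0 \<le> weight h w"
  by (induction w) auto

text \<open>The separation time of the coupling takes the value \<open>k\<close> with probability
  \<open>mass h k - mass h (Suc k)\<close>, and \<open>b k\<close> bounds the discrepancy of expectations that can arise
  after a separation at that time. The proof telescopes over the separation time.\<close>

lemma expect_diff_le_coupling:
  assumes h0: "\<And>w a. 0 \<le> h w a"
    and hs: "\<And>w a. h w a \<le> G (w @- s) a" and ht: "\<And>w a. h w a \<le> G (w @- t) a"
    and b: "\<And>w a a'. length w < n \<Longrightarrow>
       expect (n - Suc (length w)) ((a # w) @- s) (\<lambda>v. f (v @ a # w))
       - expect (n - Suc (length w)) ((a' # w) @- t) (\<lambda>v. f (v @ a' # w)) \<le> b (length w)"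
  shows "expect n s f - expect n t f \<le> (\<Sum>k<n. b k * (mass h k - mass h (Suc k)))"
proof -
  \<comment> \<open>the discrepancy that is still open when the two copies have agreed for \<open>k\<close> steps\<close>
  define gap where "gap w = expect (n - length w) (w @- s) (\<lambda>v. f (v @ w))
                          - expect (n - length w) (w @- t) (\<lambda>v. f (v @ w))" for w
  define total where "total k = (\<Sum>w\<in>words k. weight h w * gap w)" for k
  have gap_step: "gap w \<le> (\<Sum>a\<in>UNIV. h w a * gap (a # w)) + b k * (1 - (\<Sum>a\<in>UNIV. h w a))"
    if "length w = k" "k < n" for w k
  proof -
    obtain j where j: "n - length w = Suc j" "n - Suc (length w) = j"
      using \<open>k < n\<close> \<open>length w = k\<close> by (metis Suc_diff_Suc)
    show ?thesis
      unfolding gap_def j expect_Suc_right length_Cons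
      using one_step_coupling[OF G_sum G_sum hs[of w] ht[of w],
          of "\<lambda>a. expect j (a ## w @- s) (\<lambda>v. f (v @ a # w))"
             "\<lambda>a. expect j (a ## w @- t) (\<lambda>v. f (v @ a # w))" "b k"]
        b[of w] that j by simp
  qed
  have total_step: "total k \<le> total (Suc k) + b k * (mass h k - mass h (Suc k))" if "k < n" for k
  proof -
    have "total k \<le> (\<Sum>w\<in>words k. weight h w *
        ((\<Sum>a\<in>UNIV. h w a * gap (a # w)) + b k * (1 - (\<Sum>a\<in>UNIV. h w a))))"
      unfolding total_def using gap_step that
      by (intro sum_mono mult_left_mono weight_nonneg h0) (auto simp: words_def)
    also have "\<dots> = total (Suc k) + b k * (mass h k - mass h (Suc k))"
      unfolding mass_step total_def sum_words_Suc
      by (simp add: distrib_left sum.distrib sum_distrib_left mult.assoc mult.left_commute)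
    finally show ?thesis .
  qed
  have "total 0 \<le> total k + (\<Sum>i<k. b i * (mass h i - mass h (Suc i)))" if "k \<le> n" for k
    using that
  proof (induction k)
    case (Suc k)
    then show ?case using total_step[of k] by simp
  qed simp
  from this[of n] show ?thesis
    by (simp add: total_def gap_def words_def)
qed

text \<open>The coupling used below. During the first \<open>N\<close> steps the copies only share the guaranteed part
  \<open>\<epsilon>\<close> of every letter, so that the common word is uniformly distributed; afterwards they share as
  much as possible. After the uniform start every word of length \<open>k \<ge> N\<close> has weight at most
  \<open>\<epsilon>\<^sup>N M\<^bsup>k - N\<^esup>\<close>, so the later loss carries the same small factor \<open>\<epsilon>\<^sup>N\<close> as the mass that has been
  kept, and the tail of the summable series decides.\<close>

definition synchro :: "nat \<Rightarrow> 'a stream \<Rightarrow> 'a stream \<Rightarrow> 'a list \<Rightarrow> 'a \<Rightarrow> real" where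
  "synchro N s t w a = (if length w < N then \<epsilon> else min (G (w @- s) a) (G (w @- t) a))"

lemma synchro_nonneg: "0 \<le> synchro N s t w a"
  using eps_pos G_nonneg by (simp add: synchro_def)

lemma synchro_le: "synchro N s t w a \<le> G (w @- s) a" "synchro N s t w a \<le> G (w @- t) a"
  using G_ge by (simp_all add: synchro_def)

lemma sum_synchro_le: "(\<Sum>a\<in>UNIV. synchro N s t w a) \<le> 1"
  using sum_mono[of UNIV "synchro N s t w" "G (w @- s)", OF synchro_le(1)] by (simp add: G_sum)

lemma weight_synchro_le:
  "weight (synchro N s t) w \<le> (if length w < N then \<epsilon> ^ length w else \<epsilon> ^ N * M ^ (length w - N))"
proof (induction w)
  case (Cons a w)
  let ?r = "\<lambda>w. (if length w < N then \<epsilon> ^ length w else \<epsilon> ^ N * M ^ (length w - N))"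
  have "weight (synchro N s t) (a # w) \<le> ?r w * (if length w < N then \<epsilon> else M)"
    unfolding weight.simps
  proof (rule mult_mono[OF Cons])
    show "synchro N s t w a \<le> (if length w < N then \<epsilon> else M)"
      using G_le[of "w @- s" a] by (auto simp: synchro_def min.coboundedI1)
  qed (use eps_pos M_pos in \<open>auto simp: synchro_nonneg\<close>)
  also have "\<dots> = ?r (a # w)"
    by (cases "Suc (length w) = N") (auto simp: Suc_diff_le)
  finally show ?case .
qed auto

lemma mass_decreasing: "mass (synchro N s t) (Suc k) \<le> mass (synchro N s t) k"
  using mass_step[of "synchro N s t" k] sum_synchro_le
  by (smt (verit) mult_nonneg_nonneg sum_nonneg synchro_nonneg weight_nonneg)

text \<open>Once the copies have agreed for \<open>k \<ge> N\<close> steps, they can separate only if the common word is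
  undetermined.\<close>

lemma mass_loss:
  assumes "N \<le> k"
  shows "mass (synchro N s t) k - mass (synchro N s t) (Suc k)
    \<le> real (card (undetermined G k)) * (\<epsilon> ^ N * M ^ (k - N))"
proof -
  let ?h = "synchro N s t"
  have "(\<Sum>w\<in>words k. weight ?h w * (1 - (\<Sum>a\<in>UNIV. ?h w a)))
      = (\<Sum>w\<in>undetermined G k. weight ?h w * (1 - (\<Sum>a\<in>UNIV. ?h w a)))"
  proof (rule sum.mono_neutral_right)
    show "\<forall>w\<in>words k - undetermined G k. weight ?h w * (1 - (\<Sum>a\<in>UNIV. ?h w a)) = 0"
    proof
      fix w assume w: "w \<in> words k - undetermined G k"
      then have "G (w @- t) a = G (w @- s) a" for a
        unfolding undetermined_def by blast
      then have "?h w = G (w @- s)"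
        using w assms by (auto simp: synchro_def words_def)
      then show "weight ?h w * (1 - (\<Sum>a\<in>UNIV. ?h w a)) = 0"
        by (simp add: G_sum)
    qed
  qed (auto simp: undetermined_def)
  also have "\<dots> \<le> (\<Sum>w\<in>undetermined G k. \<epsilon> ^ N * M ^ (k - N))"
  proof (rule sum_mono)
    fix w assume "w \<in> undetermined G k"
    then have [simp]: "length w = k" by (simp add: undetermined_def words_def)
    have "weight ?h w * (1 - (\<Sum>a\<in>UNIV. ?h w a)) \<le> weight ?h w * 1"
      by (intro mult_left_mono weight_nonneg) (auto simp: synchro_nonneg intro!: sum_nonneg)
    also have "\<dots> \<le> \<epsilon> ^ N * M ^ (k - N)"
      using weight_synchro_le[of N s t w] assms by (simp add: not_less)
    finally show "weight ?h w * (1 - (\<Sum>a\<in>UNIV. ?h w a)) \<le> \<epsilon> ^ N * M ^ (k - N)" .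
  qed
  finally show ?thesis by (simp add: mass_step)
qed

text \<open>A bound that does not involve \<open>N\<close>, for summing over late separation times.\<close>

lemma mass_loss_le:
  assumes "N \<le> k"
  shows "mass (synchro N s t) k - mass (synchro N s t) (Suc k) \<le> real (card (undetermined G k)) * M ^ k"
proof -
  have "\<epsilon> ^ N * M ^ (k - N) \<le> M ^ N * M ^ (k - N)"
    using eps_pos eps_le_M M_pos by (intro mult_right_mono power_mono) auto
  also have "\<dots> = M ^ k"
    using assms by (simp add: power_add[symmetric])
  finally show ?thesis
    using mass_loss[OF assms, of s t] by (smt (verit, best) mult_left_mono of_nat_0_le_iff)
qed

lemma mass_synchro_initial: "k \<le> N \<Longrightarrow> mass (synchro N s t) k = (real CARD('a) * \<epsilon>) ^ k"
proof (induction k)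
  case (Suc k)
  have "mass (synchro N s t) (Suc k) = (\<Sum>w\<in>words k. \<Sum>a\<in>(UNIV::'a set). weight (synchro N s t) w * \<epsilon>)"
    unfolding mass_def sum_words_Suc using Suc.prems
    by (intro sum.cong refl) (auto simp: synchro_def words_def)
  also have "\<dots> = mass (synchro N s t) k * (real CARD('a) * \<epsilon>)"
    by (simp add: mass_def sum_distrib_left sum_distrib_right algebra_simps)
  finally show ?case using Suc by simp
qed (simp add: mass_def)

lemma tail_small:
  assumes "c > 0"
  obtains N where "\<And>n. (\<Sum>k\<in>{N..<n}. real (card (undetermined G k)) * M ^ k) < c"
proof -
  from summable_undetermined[unfolded summable_Cauchy, rule_format, OF assms]
  obtain N where "\<And>n. norm (\<Sum>k\<in>{N..<n}. real (card (undetermined G k)) * M ^ k) < c"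
    by blast
  then show thesis by (intro that[of N]) (metis abs_le_D1 le_less_trans order_refl real_norm_def)
qed

text \<open>The copies stay together forever with positive probability, uniformly in the two pasts. After
  \<open>N\<close> steps they are together with mass \<open>(|A| \<epsilon>)\<^sup>N \<ge> (\<epsilon> / M)\<^sup>N\<close>, and what is lost later is at most
  \<open>(\<epsilon> / M)\<^sup>N\<close> times the tail of the series from \<open>N\<close> on, which is less than \<open>1/2\<close> for large \<open>N\<close>.\<close>

lemma synchro_positive:
  obtains N \<delta> where "0 < \<delta>" "\<delta> \<le> 1" "\<And>s t n. \<delta> \<le> mass (synchro N s t) n"
proof -
  obtain N where tail: "\<And>n. (\<Sum>k\<in>{N..<n}. real (card (undetermined G k)) * M ^ k) < 1/2"
    using tail_small[of "1/2"] by auto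
  define \<delta> where "\<delta> = (\<epsilon> / M) ^ N / 2"
  have late: "\<delta> \<le> mass (synchro N s t) n" if "N \<le> n" for s t n
  proof -
    let ?m = "mass (synchro N s t)"
    have "?m N - ?m n = (\<Sum>k\<in>{N..<n}. ?m k - ?m (Suc k))"
      using that sum_Suc_diff'[of N n "\<lambda>k. - ?m k"] by (simp add: algebra_simps)
    also have "\<dots> \<le> (\<Sum>k\<in>{N..<n}. (\<epsilon> / M) ^ N * (real (card (undetermined G k)) * M ^ k))"
    proof (rule sum_mono)
      fix k assume k: "k \<in> {N..<n}"
      have "\<epsilon> ^ N * M ^ (k - N) = (\<epsilon> / M) ^ N * M ^ k"
        using k M_pos by (simp add: power_divide power_diff)
      then show "?m k - ?m (Suc k) \<le> (\<epsilon> / M) ^ N * (real (card (undetermined G k)) * M ^ k)"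
        using mass_loss[of N k s t] k by (simp add: algebra_simps)
    qed
    also have "\<dots> \<le> (\<epsilon> / M) ^ N * (1/2)"
      unfolding sum_distrib_left[symmetric]
      using tail[of n] eps_pos M_pos by (intro mult_left_mono) auto
    finally have "?m N - \<delta> \<le> ?m n" by (simp add: \<delta>_def)
    moreover have "(\<epsilon> / M) ^ N \<le> ?m N"
    proof -
      have "\<epsilon> / M \<le> real CARD('a) * \<epsilon>"
        using card_M_ge_1 eps_pos M_pos mult_left_mono[OF card_M_ge_1, of \<epsilon>]
        by (simp add: field_simps)
      then have "(\<epsilon> / M) ^ N \<le> (real CARD('a) * \<epsilon>) ^ N"
        using eps_pos M_pos by (intro power_mono) auto
      then show ?thesis by (simp add: mass_synchro_initial)
    qed
    ultimately show ?thesis by (simp add: \<delta>_def)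
  qed
  have *: "\<delta> \<le> mass (synchro N s t) n" for s t n
  proof -
    have "mass (synchro N s t) (max n N) \<le> mass (synchro N s t) n"
      by (rule lift_Suc_antimono_le[of "mass (synchro N s t)"]) (auto intro: mass_decreasing)
    then show ?thesis using late[of "max n N" s t] by simp
  qed
  have "0 < \<delta>" using eps_pos M_pos by (simp add: \<delta>_def)
  moreover have "\<delta> \<le> 1"
    using *[of undefined undefined 0] by (simp add: mass_def)
  ultimately show thesis using that * by blast
qed

text \<open>After a gap of \<open>m\<close> letters, the laws of a block of any length, started from two arbitrary
  pasts, differ by at most \<open>c\<close> in total variation.\<close>

definition forgets :: "nat \<Rightarrow> real \<Rightarrow> bool" where
  "forgets m c \<longleftrightarrow> (\<forall>L f s t. (\<forall>w. 0 \<le> f w \<and> f w \<le> 1) \<longrightarrow>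
     expect (m + L) s (\<lambda>w. f (take L w)) - expect (m + L) t (\<lambda>w. f (take L w)) \<le> c)"

lemma expect_unit: "(\<And>w. 0 \<le> f w \<and> f w \<le> 1) \<Longrightarrow> 0 \<le> expect n s f \<and> expect n s f \<le> 1"
  using expect_mono[of n "\<lambda>_. 0" f s] expect_mono[of n f "\<lambda>_. 1" s] by simp

lemma forgetsD:
  assumes "forgets m c" "\<And>w. 0 \<le> f w \<and> f w \<le> 1" "m + L \<le> n"
  shows "expect n s (\<lambda>w. f (take L w)) - expect n t (\<lambda>w. f (take L w)) \<le> c"
proof -
  \<comment> \<open>a function of the last \<open>L\<close> letters is one of the last \<open>n - m\<close> letters\<close>
  have "take L w = take L (take (n - m) w)" for w :: "'a list"
    using assms(3) by (simp add: min_absorb1)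
  moreover have "n = m + (n - m)" using assms(3) by simp
  ultimately show ?thesis
    using assms(1)[unfolded forgets_def, rule_format, of "\<lambda>w. f (take L w)" "n - m" s t] assms(2)
    by simp
qed

lemma forgets_0: "forgets 0 1"
  unfolding forgets_def
proof (intro allI impI)
  fix L :: nat and f :: "'a list \<Rightarrow> real" and s t assume f: "\<forall>w. 0 \<le> f w \<and> f w \<le> 1"
  show "expect (0 + L) s (\<lambda>w. f (take L w)) - expect (0 + L) t (\<lambda>w. f (take L w)) \<le> 1"
    using expect_unit[of "\<lambda>w. f (take L w)" "0 + L" s] expect_unit[of "\<lambda>w. f (take L w)" "0 + L" t] f
    by (smt (verit))
qed

text \<open>A separation before time \<open>q\<close> leaves a gap of length at least \<open>m\<close>, and the hypothesis applies to the two
  separated copies; this costs \<open>c\<close> times the separation probability, at most \<open>(1 - \<delta>) c\<close>.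
  A separation at time \<open>q\<close> or later has probability at most \<open>\<delta> c / 2\<close>.\<close>

lemma forgets_contraction:
  assumes "\<And>s t n. \<delta> \<le> mass (synchro N s t) n" "0 < \<delta>" "forgets m c" "0 < c"
  obtains m' where "forgets m' ((1 - \<delta> / 2) * c)"
proof -
  obtain q0 where tail0: "\<And>n. (\<Sum>k\<in>{q0..<n}. real (card (undetermined G k)) * M ^ k) < \<delta> * c / 2"
    using tail_small[of "\<delta> * c / 2"] assms(2,4) by auto
  \<comment> \<open>\<open>q \<ge> N\<close> since the loss is controlled only after the uniform start\<close>
  define q where "q = max q0 N"
  have "forgets (m + q) ((1 - \<delta> / 2) * c)"
    unfolding forgets_def
  proof (intro allI impI)
    fix L :: nat and f :: "'a list \<Rightarrow> real" and s t assume f: "\<forall>w. 0 \<le> f w \<and> f w \<le> 1"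
    define n where "n = m + q + L"
    define h where "h = synchro N s t"
    define b where "b k = (if k < q then c else 1)" for k
    have "expect n s (\<lambda>w. f (take L w)) - expect n t (\<lambda>w. f (take L w))
      \<le> (\<Sum>k<n. b k * (mass h k - mass h (Suc k)))"
    proof (rule expect_diff_le_coupling)
      fix w :: "'a list" and a a' assume w: "length w < n"
      let ?j = "n - Suc (length w)"
      show "expect ?j ((a # w) @- s) (\<lambda>v. f (take L (v @ a # w)))
          - expect ?j ((a' # w) @- t) (\<lambda>v. f (take L (v @ a' # w))) \<le> b (length w)"
      proof (cases "length w < q")
        case True
        then have j: "m + L \<le> ?j" by (simp add: n_def)
        have "expect ?j ((d # w) @- z) (\<lambda>v. f (take L (v @ d # w)))
            = expect ?j ((d # w) @- z) (\<lambda>v. f (take L v))" for d z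
          using j by (intro expect_cong) simp
        then show ?thesis
          using forgetsD[OF assms(3) _ j, of f] f True by (simp add: b_def)
      next
        case False
        then show ?thesis
          using expect_unit[of "\<lambda>v. f (take L (v @ a # w))" ?j "(a # w) @- s"]
            expect_unit[of "\<lambda>v. f (take L (v @ a' # w))" ?j "(a' # w) @- t"] f
          unfolding b_def by (smt (verit))
      qed
    qed (auto simp: h_def synchro_nonneg synchro_le)
    also have "\<dots> = (\<Sum>k<q. b k * (mass h k - mass h (Suc k))) + (\<Sum>k\<in>{q..<n}. b k * (mass h k - mass h (Suc k)))"
      unfolding atLeast0LessThan[symmetric]
      by (rule sum.atLeastLessThan_concat[symmetric]) (auto simp: n_def)
    also have "(\<Sum>k<q. b k * (mass h k - mass h (Suc k))) = c * (1 - mass h q)"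
    proof -
      have "(\<Sum>k<q. b k * (mass h k - mass h (Suc k))) = c * (\<Sum>k<q. mass h k - mass h (Suc k))"
        by (simp add: b_def sum_distrib_left)
      also have "(\<Sum>k<q. mass h k - mass h (Suc k)) = mass h 0 - mass h q"
        by (rule sum_lessThan_telescope')
      finally show ?thesis by (simp add: mass_def)
    qed
    also have "c * (1 - mass h q) \<le> c * (1 - \<delta>)"
      using assms(1,4) by (intro mult_left_mono) (auto simp: h_def)
    also have "(\<Sum>k\<in>{q..<n}. b k * (mass h k - mass h (Suc k))) \<le> (\<Sum>k\<in>{q..<n}. real (card (undetermined G k)) * M ^ k)"
      using mass_loss_le[of N] by (intro sum_mono) (auto simp: b_def h_def q_def)
    also have "\<dots> \<le> (\<Sum>k\<in>{q0..<n}. real (card (undetermined G k)) * M ^ k)"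
      using M_pos by (intro sum_mono2) (auto simp: q_def)
    also have "\<dots> \<le> \<delta> * c / 2"
      using tail0[of n] by simp
    finally show "expect (m + q + L) s (\<lambda>w. f (take L w)) - expect (m + q + L) t (\<lambda>w. f (take L w))
        \<le> (1 - \<delta> / 2) * c"
      by (simp add: n_def algebra_simps)
  qed
  then show thesis using that by blast
qed

theorem uniform_forgetting:
  assumes "c > 0"
  obtains m where "forgets m c"
proof -
  obtain N \<delta> where \<delta>: "0 < \<delta>" "\<delta> \<le> 1" "\<And>s t n. \<delta> \<le> mass (synchro N s t) n"
    using synchro_positive by metis
  have ex: "\<exists>m. forgets m ((1 - \<delta> / 2) ^ j)" for j
  proof (induction j)
    case 0
    then show ?case using forgets_0 by auto
  next
    case (Suc j)
    then obtain m where "forgets m ((1 - \<delta> / 2) ^ j)" by blast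
    moreover have "0 < (1 - \<delta> / 2) ^ j" using \<delta>(2) by (intro zero_less_power) auto
    ultimately show ?case using forgets_contraction[OF \<delta>(3,1)] by (metis power_Suc)
  qed
  obtain j where j: "(1 - \<delta> / 2) ^ j < c"
    using real_arch_pow_inv[OF assms, of "1 - \<delta> / 2"] \<delta> by auto
  from ex[of j] obtain m where "forgets m ((1 - \<delta> / 2) ^ j)" by blast
  then have "forgets m c"
    unfolding forgets_def using j by (smt (verit))
  then show thesis by (rule that)
qed

end

context chain
begin

section \<open>The limiting word frequencies\<close>

lemma expect_take_split:
  assumes "L \<le> m"
  shows "expect (m + k) s (\<lambda>w. f (take L w)) = expect k s (\<lambda>u. expect m (u @- s) (\<lambda>v. f (take L v)))"
  unfolding expect_add using assms by (intro expect_cong) simp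

text \<open>The blocks may also be observed at different times, because a longer run is an average over the
  pasts that its first letters produce.\<close>

lemma forgets_abs:
  assumes "forgets m c" "\<And>w. 0 \<le> f w \<and> f w \<le> 1" "m + L \<le> n" "m + L \<le> n'"
  shows "\<bar>expect n s (\<lambda>w. f (take L w)) - expect n' t (\<lambda>w. f (take L w))\<bar> \<le> c"
proof -
  have *: "expect n s (\<lambda>w. f (take L w)) \<le> c + expect n' t (\<lambda>w. f (take L w))"
    if le: "m + L \<le> n" "m + L \<le> n'" for n n' s t
  proof -
    obtain k k' where k: "n = m + L + k" "n' = m + L + k'"
      using le_Suc_ex[OF le(1)] le_Suc_ex[OF le(2)] by blast
    have "expect n s (\<lambda>w. f (take L w)) \<le> c + expect (m + L) z (\<lambda>w. f (take L w))" for z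
    proof -
      have "expect n s (\<lambda>w. f (take L w)) \<le> expect k s (\<lambda>u. c + expect (m + L) z (\<lambda>w. f (take L w)))"
        unfolding k(1) expect_take_split[OF le_add2[of L m]]
      proof (rule expect_mono)
        show "expect (m + L) (u @- s) (\<lambda>w. f (take L w)) \<le> c + expect (m + L) z (\<lambda>w. f (take L w))" for u
          using forgetsD[where f = f and L = L and s = "u @- s" and t = z, OF assms(1,2) order_refl]
          by simp
      qed
      then show ?thesis by simp
    qed
    then have "expect k' t (\<lambda>u. expect n s (\<lambda>w. f (take L w)))
        \<le> expect k' t (\<lambda>u. c + expect (m + L) (u @- t) (\<lambda>w. f (take L w)))"
      by (intro expect_mono)
    also have "\<dots> = c + expect n' t (\<lambda>w. f (take L w))"
      unfolding k(2) expect_take_split[OF le_add2[of L m]]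
      using expect_diff[of k' t "\<lambda>u. c + expect (m + L) (u @- t) (\<lambda>w. f (take L w))" "\<lambda>_. c"] by simp
    finally show ?thesis by simp
  qed
  show ?thesis
    using *[OF assms(3,4), of s t] *[OF assms(4,3), of t s] by linarith
qed

abbreviation "origin \<equiv> sconst (undefined :: 'a)"

text \<open>The limit does not depend on the past from which the chain starts (\<open>forgets_freq\<close> below);
  \<open>origin\<close> is an arbitrary one.\<close>

definition freq :: "'a list \<Rightarrow> real" where
  "freq w = lim (\<lambda>n. expect n origin (\<lambda>v. of_bool (take (length w) v = w)))"

lemma freq_LIMSEQ: "(\<lambda>n. expect n origin (\<lambda>v. of_bool (take (length w) v = w))) \<longlonglongrightarrow> freq w"
proof -
  have "Cauchy (\<lambda>n. expect n origin (\<lambda>v. of_bool (take (length w) v = w)))"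
  proof (rule metric_CauchyI)
    fix e :: real assume "0 < e"
    then obtain m where m: "forgets m (e / 2)"
      using uniform_forgetting[of "e / 2"] by auto
    have "dist (expect n origin (\<lambda>v. of_bool (take (length w) v = w)))
        (expect n' origin (\<lambda>v. of_bool (take (length w) v = w))) < e"
      if "m + length w \<le> n" "m + length w \<le> n'" for n n'
      using forgets_abs[OF m _ that, of "\<lambda>v. of_bool (v = w)" origin origin] \<open>0 < e\<close>
      by (simp add: dist_real_def)
    then show "\<exists>N. \<forall>n\<ge>N. \<forall>n'\<ge>N. dist (expect n origin (\<lambda>v. of_bool (take (length w) v = w)))
        (expect n' origin (\<lambda>v. of_bool (take (length w) v = w))) < e"
      by blast
  qed
  then show ?thesis
    unfolding freq_def by (simp only: convergent_LIMSEQ_iff[symmetric] Cauchy_convergent_iff)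
qed

lemma freq_LIMSEQ_sum:
  "(\<lambda>n. expect n origin (\<lambda>v. f (take L v))) \<longlonglongrightarrow> (\<Sum>w\<in>words L. freq w * f w)"
proof (rule Lim_transform_eventually)
  show "(\<lambda>n. \<Sum>w\<in>words L. expect n origin (\<lambda>v. of_bool (take (length w) v = w)) * f w)
      \<longlonglongrightarrow> (\<Sum>w\<in>words L. freq w * f w)"
    by (intro tendsto_sum tendsto_mult freq_LIMSEQ tendsto_const)
  have "(\<Sum>w\<in>words L. expect n origin (\<lambda>v. of_bool (take (length w) v = w)) * f w)
      = expect n origin (\<lambda>v. f (take L v))" if "n \<ge> L" for n
  proof -
    have "(\<Sum>w\<in>words L. expect n origin (\<lambda>v. of_bool (take (length w) v = w)) * f w)
      = expect n origin (\<lambda>v. \<Sum>w\<in>words L. of_bool (take (length w) v = w) * f w)"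
      unfolding expect_sum by (simp only: expect_def sum_distrib_left sum_distrib_right mult.assoc)
    also have "\<dots> = expect n origin (\<lambda>v. f (take L v))"
    proof (rule expect_cong)
      fix v :: "'a list" assume "length v = n"
      then have "take L v \<in> words L" using that by (simp add: words_def)
      moreover have "(\<Sum>w\<in>words L. of_bool (take (length w) v = w) * f w)
          = (\<Sum>w\<in>words L. if take L v = w then f w else 0)"
        by (intro sum.cong) (auto simp: words_def)
      ultimately show "(\<Sum>w\<in>words L. of_bool (take (length w) v = w) * f w) = f (take L v)"
        by simp
    qed
    finally show ?thesis .
  qed
  then show "\<forall>\<^sub>F n in sequentially.
      (\<Sum>w\<in>words L. expect n origin (\<lambda>v. of_bool (take (length w) v = w)) * f w)
      = expect n origin (\<lambda>v. f (take L v))"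
    by (rule eventually_sequentiallyI)
qed

text \<open>Hence the law of any block of letters, seen after a gap of length \<open>m\<close>, is uniformly close to the limit.\<close>

lemma forgets_freq:
  assumes "forgets m c" "\<And>w. 0 \<le> f w \<and> f w \<le> 1" "m + L \<le> n"
  shows "\<bar>expect n s (\<lambda>w. f (take L w)) - (\<Sum>w\<in>words L. freq w * f w)\<bar> \<le> c"
proof (rule LIMSEQ_le_const2)
  show "(\<lambda>n'. \<bar>expect n s (\<lambda>w. f (take L w)) - expect n' origin (\<lambda>v. f (take L v))\<bar>)
      \<longlonglongrightarrow> \<bar>expect n s (\<lambda>w. f (take L w)) - (\<Sum>w\<in>words L. freq w * f w)\<bar>"
    by (intro tendsto_rabs tendsto_diff tendsto_const freq_LIMSEQ_sum[of f L])
  show "\<exists>N. \<forall>n'\<ge>N. \<bar>expect n s (\<lambda>w. f (take L w)) - expect n' origin (\<lambda>v. f (take L v))\<bar> \<le> c"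
    using forgets_abs[OF assms(1) _ assms(3), of f _ s origin] assms(2) by blast
qed

lemma freq_nonneg: "0 \<le> freq w"
proof (rule LIMSEQ_le_const[OF freq_LIMSEQ])
  have "0 \<le> expect n origin (\<lambda>v. of_bool (take (length w) v = w))" for n
    by (rule expect_unit[THEN conjunct1]) simp
  then show "\<exists>N. \<forall>n\<ge>N. 0 \<le> expect n origin (\<lambda>v. of_bool (take (length w) v = w))"
    by blast
qed

lemma sum_freq: "(\<Sum>w\<in>words L. freq w) = 1"
  using LIMSEQ_unique[OF freq_LIMSEQ_sum[of "\<lambda>_. 1" L]] by simp

lemma expect_word: "expect (length w) s (\<lambda>v. of_bool (v = w)) = word_prob s w"
proof -
  have "w \<in> words (length w)" by (simp add: words_def)
  then show ?thesis
    by (simp add: expect_def if_distrib of_bool_def cong: if_cong)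
qed

lemma expect_take_word_le:
  assumes "length w \<le> n"
  shows "expect n s (\<lambda>v. of_bool (take (length w) v = w)) \<le> M ^ length w"
proof -
  obtain k where k: "n = length w + k" using le_Suc_ex[OF assms] by blast
  have "expect (length w) z (\<lambda>v. of_bool (take (length w) v = w)) \<le> M ^ length w" for z
  proof -
    have "expect (length w) z (\<lambda>v. of_bool (take (length w) v = w)) = word_prob z w"
      unfolding expect_word[symmetric] by (rule expect_cong) simp
    then show ?thesis using word_prob_le by simp
  qed
  then have "expect k s (\<lambda>u. expect (length w) (u @- s) (\<lambda>v. of_bool (take (length w) v = w))) \<le> expect k s (\<lambda>_. M ^ length w)"
    by (intro expect_mono)
  then show ?thesis
    unfolding k expect_take_split[of "length w" "length w" k s "\<lambda>v. of_bool (v = w)", OF order_refl]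
    by simp
qed

lemma freq_le: "freq w \<le> M ^ length w"
  by (rule LIMSEQ_le_const2[OF freq_LIMSEQ]) (use expect_take_word_le in blast)

text \<open>Removing the newest letter amounts to looking one step earlier, and removing the oldest one
  (next lemma) to looking at a shorter block. Together they make the frequencies the word
  probabilities of a stationary process.\<close>

lemma sum_freq_Cons: "(\<Sum>a\<in>UNIV. freq (a # w)) = freq w"
proof (rule LIMSEQ_unique)
  show "(\<lambda>n. \<Sum>a\<in>UNIV. expect (Suc n) origin (\<lambda>v. of_bool (take (length (a # w)) v = a # w)))
      \<longlonglongrightarrow> (\<Sum>a\<in>UNIV. freq (a # w))"
    by (intro tendsto_sum LIMSEQ_Suc[OF freq_LIMSEQ])
  have "(\<Sum>a\<in>UNIV. expect (Suc n) origin (\<lambda>v. of_bool (take (length (a # w)) v = a # w)))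
      = expect n origin (\<lambda>v. of_bool (take (length w) v = w))" for n
  proof -
    have "(\<Sum>a\<in>(UNIV :: 'a set). expect (Suc n) origin (\<lambda>v. of_bool (take (length (a # w)) v = a # w)))
      = expect (1 + n) origin (\<lambda>v. of_bool (take (length w) (tl v) = w))"
      unfolding expect_sum[symmetric] plus_1_eq_Suc
    proof (rule expect_cong)
      fix v :: "'a list" assume "length v = Suc n"
      then obtain b u where "v = b # u" by (metis length_Suc_conv)
      then show "(\<Sum>a\<in>(UNIV :: 'a set). of_bool (take (length (a # w)) v = a # w))
          = (of_bool (take (length w) (tl v) = w) :: real)"
        by (cases "take (length w) u = w") (auto simp: of_bool_def)
    qed
    also have "\<dots> = expect n origin (\<lambda>u. expect 1 (u @- origin) (\<lambda>_. of_bool (take (length w) u = w)))"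
      unfolding expect_add
    proof (rule expect_cong, rule expect_cong)
      fix v u :: "'a list" assume "length v = 1"
      then have "tl (v @ u) = u" by (cases v) auto
      then show "(of_bool (take (length w) (tl (v @ u)) = w) :: real) = of_bool (take (length w) u = w)"
        by simp
    qed
    finally show ?thesis by simp
  qed
  then show "(\<lambda>n. \<Sum>a\<in>UNIV. expect (Suc n) origin (\<lambda>v. of_bool (take (length (a # w)) v = a # w)))
      \<longlonglongrightarrow> freq w"
    using freq_LIMSEQ[of w] by simp
qed

lemma sum_freq_snoc: "(\<Sum>a\<in>UNIV. freq (w @ [a])) = freq w"
proof (rule LIMSEQ_unique)
  show "(\<lambda>n. \<Sum>a\<in>UNIV. expect n origin (\<lambda>v. of_bool (take (length (w @ [a])) v = w @ [a])))
      \<longlonglongrightarrow> (\<Sum>a\<in>UNIV. freq (w @ [a]))"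
    by (intro tendsto_sum freq_LIMSEQ)
  have "(\<Sum>a\<in>(UNIV :: 'a set). expect n origin (\<lambda>v. of_bool (take (length (w @ [a])) v = w @ [a])))
      = expect n origin (\<lambda>v. of_bool (take (length w) v = w))" if "Suc (length w) \<le> n" for n
    unfolding expect_sum[symmetric]
  proof (rule expect_cong)
    fix v :: "'a list" assume "length v = n"
    then have "take (Suc (length w)) v = take (length w) v @ [v ! length w]"
      using that by (simp add: take_Suc_conv_app_nth)
    then show "(\<Sum>a\<in>(UNIV :: 'a set). of_bool (take (length (w @ [a])) v = w @ [a]))
        = (of_bool (take (length w) v = w) :: real)"
      by (cases "take (length w) v = w") (auto simp: of_bool_def)
  qed
  then show "(\<lambda>n. \<Sum>a\<in>UNIV. expect n origin (\<lambda>v. of_bool (take (length (w @ [a])) v = w @ [a])))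
      \<longlonglongrightarrow> freq w"
    by (intro Lim_transform_eventually[OF freq_LIMSEQ[of w]] eventually_sequentiallyI[of "Suc (length w)"])
       (rule sym)
qed

definition block :: "nat \<Rightarrow> 'a list pmf" where
  "block L = embed_pmf (\<lambda>w. if w \<in> words L then freq w else 0)"

lemma pmf_block: "pmf (block L) w = (if w \<in> words L then freq w else 0)"
  unfolding block_def
proof (rule pmf_embed_pmf)
  have "(\<integral>\<^sup>+ w. ennreal (if w \<in> words L then freq w else 0) \<partial>count_space UNIV)
      = (\<integral>\<^sup>+ w. ennreal (freq w) \<partial>count_space (words L))"
    by (subst nn_integral_count_space_indicator) (auto simp: indicator_def intro!: nn_integral_cong)
  also have "\<dots> = ennreal (\<Sum>w\<in>words L. freq w)"
    by (simp add: nn_integral_count_space_finite freq_nonneg sum_nonneg)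
  finally show "(\<integral>\<^sup>+ w. ennreal (if w \<in> words L then freq w else 0) \<partial>count_space UNIV) = 1"
    by (simp add: sum_freq)
qed (simp add: freq_nonneg)

lemma set_block: "set_pmf (block L) \<subseteq> words L"
  by (auto simp: set_pmf_eq pmf_block)

lemma measure_block: "measure (block L) W = (\<Sum>w\<in>words L \<inter> W. freq w)"
proof -
  have "measure (block L) W = measure (block L) (words L \<inter> W)"
    using set_block by (intro measure_eq_AE) (auto simp: AE_measure_pmf_iff)
  then show ?thesis
    by (simp add: measure_measure_pmf_finite pmf_block)
qed

lemma map_tl_block: "map_pmf tl (block (Suc L)) = block L"
proof (rule pmf_eqI)
  fix w
  have "pmf (map_pmf tl (block (Suc L))) w = (\<Sum>v\<in>words (Suc L). freq v * of_bool (tl v = w))"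
    by (simp add: pmf_map measure_block if_distrib of_bool_def sum.If_cases cong: if_cong) (auto intro!: sum.cong)
  also have "\<dots> = (\<Sum>u\<in>words L. (\<Sum>a\<in>UNIV. freq (a # u)) * of_bool (u = w))"
    by (simp add: sum_words_Suc sum_distrib_right)
  also have "\<dots> = pmf (block L) w"
    by (simp add: sum_freq_Cons pmf_block of_bool_def if_distrib cong: if_cong)
  finally show "pmf (map_pmf tl (block (Suc L))) w = pmf (block L) w" .
qed

lemma map_butlast_block: "map_pmf butlast (block (Suc L)) = block L"
proof (rule pmf_eqI)
  fix w
  have "pmf (map_pmf butlast (block (Suc L))) w = (\<Sum>v\<in>words (Suc L). freq v * of_bool (butlast v = w))"
    by (simp add: pmf_map measure_block if_distrib of_bool_def sum.If_cases cong: if_cong) (auto intro!: sum.cong)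
  also have "\<dots> = (\<Sum>u\<in>words L. (\<Sum>a\<in>UNIV. freq (u @ [a])) * of_bool (u = w))"
    unfolding sum_words_Suc_right by (subst sum.swap) (simp add: sum_distrib_right)
  also have "\<dots> = pmf (block L) w"
    by (simp add: sum_freq_snoc pmf_block of_bool_def if_distrib cong: if_cong)
  finally show "pmf (map_pmf butlast (block (Suc L))) w = pmf (block L) w" .
qed

lemma map_drop_block: "map_pmf (drop d) (block (d + L)) = block L"
proof (induction d)
  case (Suc d)
  have "map_pmf (drop (Suc d)) (block (Suc d + L)) = map_pmf (drop d) (map_pmf tl (block (Suc (d + L))))"
    unfolding pmf.map_comp o_def by (intro map_pmf_cong) (auto simp: drop_Suc)
  then show ?case using Suc by (simp add: map_tl_block)
qed (simp add: pmf.map_ident drop_0[abs_def] id_def)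

lemma map_take_block: "map_pmf (take L) (block (L + e)) = block L"
proof (induction e)
  case 0
  have "map_pmf (take L) (block L) = map_pmf (\<lambda>w. w) (block L)"
    using set_block by (intro map_pmf_cong) (auto simp: words_def)
  then show ?case by (simp add: pmf.map_ident)
next
  case (Suc e)
  have "map_pmf (take L) (block (L + Suc e)) = map_pmf (take L) (map_pmf butlast (block (Suc (L + e))))"
    unfolding pmf.map_comp o_def
    using set_block[of "L + Suc e"] by (intro map_pmf_cong) (auto simp: words_def take_butlast)
  then show ?case using Suc by (simp add: map_butlast_block)
qed

lemma map_window_block: "map_pmf (\<lambda>w. take L (drop d w)) (block (d + (L + e))) = block L"
proof -
  have "map_pmf (\<lambda>w. take L (drop d w)) (block (d + (L + e)))
      = map_pmf (take L) (map_pmf (drop d) (block (d + (L + e))))"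
    by (simp add: pmf.map_comp o_def)
  then show ?thesis by (simp add: map_drop_block map_take_block)
qed

text \<open>For the chain started from \<open>origin\<close>, the letter after the block \<open>w\<close> is chosen by \<open>G\<close> from the
  whole past. Only the last \<open>k\<close> letters \<open>v\<close> matter, and the remote past may be replaced by any \<open>z\<close>,
  unless \<open>v\<close> is undetermined.\<close>

lemma freq_Cons_approx:
  assumes "length w \<le> k"
  shows "\<bar>freq (a # w) - (\<Sum>v\<in>words k. freq v * (of_bool (take (length w) v = w) * G (v @- z) a))\<bar>
    \<le> real (card (undetermined G k)) * M ^ k"
proof (rule LIMSEQ_le_const2)
  let ?F = "\<lambda>v. of_bool (take (length w) v = w) * G (v @- z) a"
  have F: "?F (take k u) = of_bool (take (length w) u = w) * G (take k u @- z) a" for u :: "'a list"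
    using assms by (simp add: min_absorb1)
  show "(\<lambda>n. \<bar>expect (Suc n) origin (\<lambda>v. of_bool (take (length (a # w)) v = a # w))
        - expect n origin (\<lambda>u. ?F (take k u))\<bar>)
      \<longlonglongrightarrow> \<bar>freq (a # w) - (\<Sum>v\<in>words k. freq v * ?F v)\<bar>"
    by (intro tendsto_rabs tendsto_diff LIMSEQ_Suc[OF freq_LIMSEQ] freq_LIMSEQ_sum[of ?F k])
  have "\<bar>expect (Suc n) origin (\<lambda>v. of_bool (take (length (a # w)) v = a # w))
        - expect n origin (\<lambda>u. ?F (take k u))\<bar> \<le> real (card (undetermined G k)) * M ^ k"
    if n: "k \<le> n" for n
  proof -
    \<comment> \<open>the indicator that the last \<open>k\<close> letters form an undetermined word\<close>
    let ?U = "\<lambda>u. \<Sum>v\<in>undetermined G k. of_bool (take (length v) u = v) :: real"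
    have step: "expect (Suc n) origin (\<lambda>v. of_bool (take (length (a # w)) v = a # w))
      = expect n origin (\<lambda>u. of_bool (take (length w) u = w) * G (u @- origin) a)"
      unfolding expect_def sum_words_Suc
      by (intro sum.cong refl) (simp add: of_bool_def if_distrib cong: if_cong)
    have close: "\<bar>of_bool (take (length w) u = w) * G (u @- origin) a - ?F (take k u)\<bar> \<le> ?U u"
      if "length u = n" for u
    proof (cases "take k u \<in> undetermined G k")
      case False
      moreover have "take k u \<in> words k" using that n by (simp add: words_def)
      ultimately have "G (take k u @- s) b = G (take k u @- t) b" for s t b
        unfolding undetermined_def by blast
      then have "G (take k u @- z) a = G (take k u @- (drop k u @- origin)) a" by blast
      also have "take k u @- (drop k u @- origin) = u @- origin"
        by (metis append_take_drop_id shift_append)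
      finally show ?thesis unfolding F by (simp add: sum_nonneg)
    next
      case True
      have "1 = of_bool (take (length (take k u)) u = take k u)"
        using that n by simp
      also have "\<dots> \<le> ?U u"
        using True by (intro member_le_sum) (auto simp: undetermined_def)
      finally have "1 \<le> ?U u" .
      moreover have "\<bar>G (u @- origin) a - G (take k u @- z) a\<bar> \<le> 1"
      proof -
        have "G s a \<le> 1" for s
          using member_le_sum[of a UNIV "G s"] G_sum[of s] G_nonneg by simp
        then show ?thesis
          using G_nonneg[of "u @- origin" a] G_nonneg[of "take k u @- z" a]
          by (smt (verit, best))
      qed
      ultimately show ?thesis unfolding F by (auto simp: of_bool_def)
    qed
    have "\<bar>expect n origin (\<lambda>u. of_bool (take (length w) u = w) * G (u @- origin) a)
        - expect n origin (\<lambda>u. ?F (take k u))\<bar>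
      \<le> expect n origin (\<lambda>u. \<bar>of_bool (take (length w) u = w) * G (u @- origin) a - ?F (take k u)\<bar>)"
      unfolding expect_diff[symmetric]
      by (simp add: expect_def) (rule order_trans[OF sum_abs], simp add: abs_mult word_prob_nonneg)
    also have "\<dots> \<le> expect n origin ?U"
      by (rule expect_mono) (rule close)
    also have "\<dots> = (\<Sum>v\<in>undetermined G k. expect n origin (\<lambda>u. of_bool (take (length v) u = v)))"
      by (rule expect_sum)
    also have "\<dots> \<le> (\<Sum>v\<in>undetermined G k. M ^ k)"
      using n expect_take_word_le[of _ n origin]
      by (intro sum_mono) (force simp: undetermined_def words_def)
    finally show ?thesis unfolding step by simp
  qed
  then show "\<exists>N. \<forall>n\<ge>N. \<bar>expect (Suc n) origin (\<lambda>v. of_bool (take (length (a # w)) v = a # w))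
        - expect n origin (\<lambda>u. ?F (take k u))\<bar> \<le> real (card (undetermined G k)) * M ^ k"
    by blast
qed

lemma undetermined_LIMSEQ: "(\<lambda>k. real (card (undetermined G k)) * M ^ k) \<longlonglongrightarrow> 0"
  by (rule summable_LIMSEQ_zero[OF summable_undetermined])

lemma sum_freq_undetermined: "(\<Sum>w\<in>undetermined G k. freq w) \<le> real (card (undetermined G k)) * M ^ k"
  using sum_bounded_above[of "undetermined G k" freq "M ^ k"] freq_le
  by (force simp: undetermined_def words_def)

end

section \<open>Cylinders\<close>

text \<open>The past of a bi-infinite sequence before time \<open>t\<close>, as a stream.\<close>

definition hist :: "int \<Rightarrow> (int \<Rightarrow> 'a) \<Rightarrow> 'a stream" where
  "hist t x = to_stream (\<lambda>k. x (t - 1 - int k))"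

lemma hist_snth [simp]: "hist t x !! k = x (t - 1 - int k)"
  by (simp add: hist_def to_stream_def)

lemma stream_eqI_snth: "(\<And>k. s !! k = t !! k) \<Longrightarrow> s = t"
  by (metis stream.map_cong smap_alt stream.map_ident)

lemma hist_step: "hist (t + 1) x = x t ## hist t x"
  by (rule stream_eqI_snth) (auto simp: Stream_snth split: nat.split intro: arg_cong[of _ _ x])

lemma hist_shift: "hist t (shift x) = hist (t + 1) x"
  by (rule stream_eqI_snth) (simp add: shift_def algebra_simps)

lemma sdrop_hist: "sdrop n (hist t x) = hist (t - int n) x"
  by (rule stream_eqI_snth) (simp add: sdrop_snth algebra_simps)

lemma stake_hist_window:
  assumes "t \<le> t'" "t' - int L' \<le> t - int L"
  shows "stake L (hist t x) = take L (drop (nat (t' - t)) (stake L' (hist t' x)))"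
proof (rule nth_equalityI)
  show "length (stake L (hist t x)) = length (take L (drop (nat (t' - t)) (stake L' (hist t' x))))"
    using assms by simp
  fix i assume "i < length (stake L (hist t x))"
  then show "stake L (hist t x) ! i = take L (drop (nat (t' - t)) (stake L' (hist t' x))) ! i"
    using assms by (simp add: stake_nth algebra_simps)
qed

lemma space_coord_algebra [simp]: "space (coord_algebra I) = UNIV"
  by (simp add: coord_algebra_def space_measure_of_conv)

lemma sets_coord_algebra: "sets (coord_algebra I) = sigma_sets UNIV {(\<lambda>x. x i) -` B | i B. i \<in> I}"
  by (simp add: coord_algebra_def)

lemma space_seqs_UNIV [simp]: "space (seqs UNIV) = UNIV"
  by (simp add: seqs_def space_PiM)

lemma sets_seqs_UNIV: "sets (seqs UNIV) = sets (coord_algebra UNIV)"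
  unfolding seqs_def sets_PiM_single sets_coord_algebra
  by (simp add: vimage_def)

lemma measurable_coord: "i \<in> I \<Longrightarrow> (\<lambda>x. x i) \<in> measurable (coord_algebra I) (count_space UNIV)"
  by (rule measurableI) (auto simp: sets_coord_algebra)

lemma cylinder_measurable:
  fixes W :: "'a::finite list set"
  assumes "{t - int L..<t} \<subseteq> I"
  shows "{x. stake L (hist t x) \<in> W} \<in> sets (coord_algebra I)"
proof -
  have [measurable]: "Measurable.pred (coord_algebra I) (\<lambda>x. x (t - 1 - int j) = (a :: 'a))" if "j < L" for j a
    using measurable_coord[of "t - 1 - int j" I] that assms
    by (intro pred_eq_const1[where N = "count_space UNIV"]) (auto simp: subset_iff)
  have "{x \<in> space (coord_algebra I). \<exists>w\<in>W \<inter> words L. \<forall>j\<in>{..<L}. x (t - 1 - int j) = w ! j}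
      \<in> sets (coord_algebra I)"
    by measurable
  also have "{x \<in> space (coord_algebra I). \<exists>w\<in>W \<inter> words L. \<forall>j\<in>{..<L}. x (t - 1 - int j) = w ! j}
      = {x. stake L (hist t x) \<in> W}"
  proof -
    have "(\<exists>w\<in>W \<inter> words L. \<forall>j\<in>{..<L}. x (t - 1 - int j) = w ! j) \<longleftrightarrow> stake L (hist t x) \<in> W" for x :: "int \<Rightarrow> 'a"
    proof
      assume "\<exists>w\<in>W \<inter> words L. \<forall>j\<in>{..<L}. x (t - 1 - int j) = w ! j"
      then obtain w where "w \<in> W" "length w = L" "\<forall>j<L. x (t - 1 - int j) = w ! j"
        by (auto simp: words_def)
      moreover from this have "stake L (hist t x) = w"
        by (intro nth_equalityI) (auto simp: stake_nth)
      ultimately show "stake L (hist t x) \<in> W" by simp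
    next
      assume "stake L (hist t x) \<in> W"
      then show "\<exists>w\<in>W \<inter> words L. \<forall>j\<in>{..<L}. x (t - 1 - int j) = w ! j"
        by (intro bexI[of _ "stake L (hist t x)"]) (auto simp: words_def stake_nth)
    qed
    then show ?thesis by simp
  qed
  finally show ?thesis .
qed

text \<open>\<open>\<tau> L\<close> is the exclusive right end of the window of length \<open>L\<close>.\<close>

definition cylinders :: "(nat \<Rightarrow> int) \<Rightarrow> (int \<Rightarrow> 'a) set set" where
  "cylinders \<tau> = {{x. stake L (hist (\<tau> L) x) \<in> W} | L W. True}"

text \<open>The windows increase and exhaust the index set \<open>I\<close>.\<close>

definition window_system :: "(nat \<Rightarrow> int) \<Rightarrow> int set \<Rightarrow> bool" where
  "window_system \<tau> I \<longleftrightarrow> mono \<tau> \<and> mono (\<lambda>L. int L - \<tau> L) \<and> I = (\<Union>L. {\<tau> L - int L..<\<tau> L})"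

lemma cylinder_widen:
  assumes "window_system \<tau> I" "L \<le> L'"
  obtains W' where "{x. stake L (hist (\<tau> L) x) \<in> W} = {x. stake L' (hist (\<tau> L') x) \<in> W'}"
proof
  have ends: "\<tau> L \<le> \<tau> L'" "\<tau> L' - int L' \<le> \<tau> L - int L"
    using assms monoD[of \<tau> L L'] monoD[of "\<lambda>L. int L - \<tau> L" L L'] by (auto simp: window_system_def)
  show "{x. stake L (hist (\<tau> L) x) \<in> W}
    = {x. stake L' (hist (\<tau> L') x) \<in> {w. take L (drop (nat (\<tau> L' - \<tau> L)) w) \<in> W}}"
    by (simp only: stake_hist_window[OF ends] mem_Collect_eq)
qed

lemma algebra_cylinders:
  assumes "window_system \<tau> I"
  shows "algebra UNIV (cylinders \<tau> :: (int \<Rightarrow> 'a) set set)"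
  unfolding algebra_iff_Un
proof (intro conjI ballI)
  show "{} \<in> (cylinders \<tau> :: (int \<Rightarrow> 'a) set set)"
    unfolding cylinders_def by (rule CollectI, rule exI[of _ 0], rule exI[of _ "{}"]) simp
next
  fix A :: "(int \<Rightarrow> 'a) set" assume "A \<in> cylinders \<tau>"
  then obtain L W where "A = {x. stake L (hist (\<tau> L) x) \<in> W}" by (auto simp: cylinders_def)
  then have "UNIV - A = {x. stake L (hist (\<tau> L) x) \<in> - W}" by auto
  then show "UNIV - A \<in> cylinders \<tau>" unfolding cylinders_def by blast
next
  fix A B :: "(int \<Rightarrow> 'a) set" assume "A \<in> cylinders \<tau>" "B \<in> cylinders \<tau>"
  then obtain L W K V where AB: "A = {x. stake L (hist (\<tau> L) x) \<in> W}" "B = {x. stake K (hist (\<tau> K) x) \<in> V}"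
    by (auto simp: cylinders_def)
  obtain W' where W': "A = {x. stake (max L K) (hist (\<tau> (max L K)) x) \<in> W'}"
    unfolding AB(1) by (rule cylinder_widen[OF assms, of L "max L K" W]) auto
  obtain V' where V': "B = {x. stake (max L K) (hist (\<tau> (max L K)) x) \<in> V'}"
    unfolding AB(2) by (rule cylinder_widen[OF assms, of K "max L K" V]) auto
  have "A \<union> B = {x. stake (max L K) (hist (\<tau> (max L K)) x) \<in> W' \<union> V'}"
    unfolding W' V' by auto
  then show "A \<union> B \<in> cylinders \<tau>" unfolding cylinders_def by blast
qed auto

lemma sets_coord_algebra_cylinders:
  assumes "window_system \<tau> I"
  shows "sets (coord_algebra I) = sigma_sets UNIV (cylinders \<tau> :: (int \<Rightarrow> 'a::finite) set set)"
proof
  show "sigma_sets UNIV (cylinders \<tau>) \<subseteq> sets (coord_algebra I :: (int \<Rightarrow> 'a) measure)"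
  proof -
    have "(cylinders \<tau> :: (int \<Rightarrow> 'a) set set) \<subseteq> sets (coord_algebra I)"
      using assms unfolding cylinders_def window_system_def by (auto intro!: cylinder_measurable)
    then show ?thesis
      using sets.sigma_sets_subset[of "cylinders \<tau>" "coord_algebra I :: (int \<Rightarrow> 'a) measure"] by simp
  qed
  show "sets (coord_algebra I) \<subseteq> sigma_sets UNIV (cylinders \<tau> :: (int \<Rightarrow> 'a) set set)"
    unfolding sets_coord_algebra
  proof (rule sigma_sets_mono, rule subsetI)
    fix A :: "(int \<Rightarrow> 'a) set" assume "A \<in> {(\<lambda>x. x i) -` B | i B. i \<in> I}"
    then obtain i B where A: "A = (\<lambda>x. x i) -` B" and "i \<in> I" by blast
    then obtain L where L: "\<tau> L - int L \<le> i" "i < \<tau> L"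
      using assms unfolding window_system_def by auto
    then have "stake L (hist (\<tau> L) x) ! nat (\<tau> L - 1 - i) = x i" for x :: "int \<Rightarrow> 'a"
      by (subst stake_nth) auto
    then have "A = {x. stake L (hist (\<tau> L) x) \<in> {w. w ! nat (\<tau> L - 1 - i) \<in> B}}"
      unfolding A by auto
    then have "A \<in> cylinders \<tau>" unfolding cylinders_def by blast
    then show "A \<in> sigma_sets UNIV (cylinders \<tau>)" by (rule sigma_sets.Basic)
  qed
qed

lemma window_system_past: "window_system (\<lambda>_. t) {..t - 1}"
proof -
  have "\<exists>L. t - int L \<le> i" for i
    by (rule exI[of _ "nat (t - i)"]) simp
  then show ?thesis
    unfolding window_system_def by (auto simp: mono_def)
qed

lemma window_system_future: "window_system (\<lambda>L. int (n + L)) {int n..}"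
proof -
  have "\<exists>L. i < int n + int L" for i
    by (rule exI[of _ "nat (i - int n + 1)"]) simp
  then show ?thesis
    unfolding window_system_def by (auto simp: mono_def)
qed

lemma window_system_all: "window_system (\<lambda>L. int (L div 2)) UNIV"
proof -
  define k where "k i = 2 * nat (\<bar>i\<bar> + 1)" for i :: int
  have "i \<in> {int (k i div 2) - int (k i)..<int (k i div 2)}" for i
    by (auto simp: k_def)
  then have "UNIV = (\<Union>L. {int (L div 2) - int L..<int (L div 2)})" by blast
  moreover have "mono (\<lambda>L. int L - int (L div 2))"
    unfolding mono_def by (intro allI impI) linarith
  ultimately show ?thesis
    by (auto simp: window_system_def mono_def div_le_mono)
qed

section \<open>Approximation of events by cylinders\<close>

text \<open>The events that can be approximated form a \<open>\<sigma>\<close>-algebra. All statements about \<open>\<sigma>\<close>-algebras of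
  the past and of the future are reduced to cylinders in this way.\<close>

lemma (in finite_measure) algebra_approx:
  assumes "algebra (space M) \<A>" "\<A> \<subseteq> sets M" "B \<in> sigma_sets (space M) \<A>" "0 < e"
  shows "\<exists>C\<in>\<A>. measure M (sym_diff B C) < e"
  using assms(3,4)
proof (induction B arbitrary: e)
  case (Basic a)
  then show ?case by (intro bexI[of _ a]) auto
next
  case Empty
  interpret algebra "space M" \<A> by fact
  show ?case using Empty by (intro bexI[of _ "{}"]) auto
next
  case (Compl a)
  interpret algebra "space M" \<A> by fact
  from Compl.IH[OF Compl.prems] obtain C where C: "C \<in> \<A>" "measure M (sym_diff a C) < e" by blast
  have sub: "a \<subseteq> space M"
    using sigma_sets_into_sp[OF space_closed Compl.hyps] by auto
  have "sym_diff (space M - a) (space M - C) = sym_diff a C"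
    using sub C(1) sets_into_space by blast
  then show ?case using C by (intro bexI[of _ "space M - C"]) auto
next
  case (Union a)
  interpret algebra "space M" \<A> by fact
  have a [measurable]: "a i \<in> sets M" for i
    using Union.hyps assms(2) sets.sigma_sets_subset by blast
  have "(\<lambda>n. measure M (\<Union>i<n. a i)) \<longlonglongrightarrow> measure M (\<Union>n. \<Union>i<n. a i)"
    by (intro finite_Lim_measure_incseq) (auto simp: incseq_def, force)
  moreover have "(\<Union>n. \<Union>i<n. a i) = (\<Union>i. a i)" by auto
  ultimately have "eventually (\<lambda>n. dist (measure M (\<Union>i<n. a i)) (measure M (\<Union>i. a i)) < e / 2) sequentially"
    using Union.prems by (intro tendstoD) auto
  then obtain n where n: "\<bar>measure M (\<Union>i<n. a i) - measure M (\<Union>i. a i)\<bar> < e / 2"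
    by (auto simp: eventually_sequentially dist_real_def)
  define d where "d = e / (2 * (real n + 1))"
  have "0 < d" using Union.prems by (simp add: d_def)
  then have "\<forall>i. \<exists>C\<in>\<A>. measure M (sym_diff (a i) C) < d" using Union.IH by blast
  then obtain C where C: "\<And>i. C i \<in> \<A>" "\<And>i. measure M (sym_diff (a i) (C i)) < d" by metis
  have [measurable]: "C i \<in> sets M" for i using C(1) assms(2) by blast
  let ?R = "(\<Union>i. a i) - (\<Union>i<n. a i)" and ?S = "\<Union>i<n. sym_diff (a i) (C i)"
  have "measure M (sym_diff (\<Union>i. a i) (\<Union>i<n. C i)) \<le> measure M (?R \<union> ?S)"
    by (intro finite_measure_mono) auto
  also have "\<dots> \<le> measure M ?R + measure M ?S"
    by (intro measure_Un_le) auto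
  also have "measure M ?R < e / 2"
  proof -
    have "measure M ?R = measure M (\<Union>i. a i) - measure M (\<Union>i<n. a i)"
      by (intro finite_measure_Diff) auto
    then show ?thesis using n by linarith
  qed
  also have "measure M ?S \<le> (\<Sum>i<n. measure M (sym_diff (a i) (C i)))"
    by (intro finite_measure_subadditive_finite) auto
  also have "\<dots> \<le> (\<Sum>i<n. d)"
    by (intro sum_mono less_imp_le C)
  also have "\<dots> \<le> e / 2"
    using Union.prems by (simp add: d_def field_simps)
  finally show ?case
    using C(1) by (intro bexI[of _ "\<Union>i<n. C i"]) auto
qed

lemma (in finite_measure) measure_diff_le_sym_diff:
  assumes [measurable]: "A \<in> sets M" "B \<in> sets M"
  shows "\<bar>measure M A - measure M B\<bar> \<le> measure M (sym_diff A B)"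
proof -
  have "measure M A \<le> measure M (B \<union> sym_diff A B)" by (intro finite_measure_mono) auto
  also have "\<dots> \<le> measure M B + measure M (sym_diff A B)" by (intro measure_Un_le) auto
  finally have 1: "measure M A \<le> measure M B + measure M (sym_diff A B)" .
  have "measure M B \<le> measure M (A \<union> sym_diff A B)" by (intro finite_measure_mono) auto
  also have "\<dots> \<le> measure M A + measure M (sym_diff A B)" by (intro measure_Un_le) auto
  finally show ?thesis using 1 by linarith
qed

section \<open>The stationary process with the limiting word frequencies\<close>

definition radius :: "int set \<Rightarrow> nat" where
  "radius J = nat (Max (insert 0 ((\<lambda>i. \<bar>i\<bar> + 1) ` J)))"

lemma radius_bounds:
  assumes "finite J" "i \<in> J"
  shows "- int (radius J) \<le> i" "i < int (radius J)"
proof -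
  have "\<bar>i\<bar> + 1 \<le> Max (insert 0 ((\<lambda>i. \<bar>i\<bar> + 1) ` J))"
    using assms by (intro Max_ge) auto
  then show "- int (radius J) \<le> i" "i < int (radius J)" by (auto simp: radius_def)
qed

lemma radius_mono: "J \<subseteq> H \<Longrightarrow> finite H \<Longrightarrow> radius J \<le> radius H"
  unfolding radius_def by (intro nat_mono Max_mono) auto

text \<open>The letters at the positions in \<open>J\<close>, read off a word that occupies the positions from \<open>-k\<close> to
  \<open>k - 1\<close>, newest letter first.\<close>

definition letters :: "nat \<Rightarrow> int set \<Rightarrow> 'a list \<Rightarrow> int \<Rightarrow> 'a discrete" where
  "letters k J w = (\<lambda>i\<in>J. discrete (w ! nat (int k - 1 - i)))"

lemma letters_in_space [simp]: "letters k J w \<in> space (PiM J (\<lambda>_. borel))"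
  by (auto simp: space_PiM letters_def)

context chain
begin

text \<open>The letters are put into the discrete Polish space \<^typ>\<open>'a discrete\<close>, where Kolmogorov's
  extension theorem applies.\<close>

definition marginal :: "int set \<Rightarrow> (int \<Rightarrow> 'a discrete) measure" where
  "marginal J = distr (block (2 * radius J)) (PiM J (\<lambda>_. borel)) (letters (radius J) J)"

lemma measurable_letters [measurable]:
  "letters k J \<in> measurable (measure_pmf p) (PiM J (\<lambda>_. borel :: 'a discrete measure))"
  by simp

text \<open>Shorter blocks are windows of longer ones, so it does not matter from which block the letters
  are read. This is the consistency condition of the extension theorem.\<close>

lemma distr_letters_cong:
  assumes "\<And>i. i \<in> J \<Longrightarrow> - int k \<le> i \<and> i < int k" "k \<le> k'"
  shows "distr (block (2 * k)) (PiM J (\<lambda>_. borel)) (letters k J)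
       = distr (block (2 * k')) (PiM J (\<lambda>_. borel)) (letters k' J)"
proof -
  define d where "d = k' - k"
  have "block (2 * k) = map_pmf (\<lambda>w. take (2 * k) (drop d w)) (block (2 * k'))"
    using map_window_block[of "2 * k" d d] assms(2) by (simp add: d_def mult_2)
  then have "distr (block (2 * k)) (PiM J (\<lambda>_. borel)) (letters k J)
      = distr (map_pmf (\<lambda>w. take (2 * k) (drop d w)) (block (2 * k'))) (PiM J (\<lambda>_. borel)) (letters k J)"
    by (simp only:)
  also have "\<dots> = distr (block (2 * k')) (PiM J (\<lambda>_. borel)) (letters k J \<circ> (\<lambda>w. take (2 * k) (drop d w)))"
    unfolding map_pmf_rep_eq by (rule distr_distr) auto
  also have "\<dots> = distr (block (2 * k')) (PiM J (\<lambda>_. borel)) (letters k' J)"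
  proof (rule distr_cong_AE)
    show "AE w in block (2 * k'). (letters k J \<circ> (\<lambda>w. take (2 * k) (drop d w))) w = letters k' J w"
    proof (rule AE_pmfI)
      fix w assume "w \<in> set_pmf (block (2 * k'))"
      then have len: "length w = 2 * k'" using set_block by (auto simp: words_def)
      show "(letters k J \<circ> (\<lambda>w. take (2 * k) (drop d w))) w = letters k' J w"
      proof
        fix i
        show "(letters k J \<circ> (\<lambda>w. take (2 * k) (drop d w))) w i = letters k' J w i"
        proof (cases "i \<in> J")
          case True
          then have "nat (int k - 1 - i) < 2 * k" "d + nat (int k - 1 - i) = nat (int k' - 1 - i)"
            using assms(1)[OF True] assms(2) by (auto simp: d_def)
          then show ?thesis
            using True len assms(2) by (simp add: letters_def d_def)
        qed (simp add: letters_def)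
      qed
    qed
  qed auto
  finally show ?thesis .
qed

lemma projective_marginal: "projective_family UNIV marginal (\<lambda>_. borel)"
proof (rule projective_family.intro)
  fix J H :: "int set" assume "J \<subseteq> H" "finite H"
  have "marginal J = distr (block (2 * radius H)) (PiM J (\<lambda>_. borel)) (letters (radius H) J)"
    unfolding marginal_def
  proof (rule distr_letters_cong)
    show "- int (radius J) \<le> i \<and> i < int (radius J)" if "i \<in> J" for i
      using radius_bounds[of J i] that finite_subset[OF \<open>J \<subseteq> H\<close> \<open>finite H\<close>] by blast
  qed (rule radius_mono[OF \<open>J \<subseteq> H\<close> \<open>finite H\<close>])
  also have "letters (radius H) J = (\<lambda>f. restrict f J) \<circ> letters (radius H) H"
    using \<open>J \<subseteq> H\<close> by (auto simp: letters_def fun_eq_iff)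
  also have "distr (block (2 * radius H)) (PiM J (\<lambda>_. borel)) ((\<lambda>f. restrict f J) \<circ> letters (radius H) H)
      = distr (marginal H) (PiM J (\<lambda>_. borel)) (\<lambda>f. restrict f J)"
    unfolding marginal_def by (rule distr_distr[symmetric]) (auto intro!: measurable_restrict_subset[OF \<open>J \<subseteq> H\<close>])
  finally show "marginal J = distr (marginal H) (PiM J (\<lambda>_. borel)) (\<lambda>f. restrict f J)" .
next
  fix J :: "int set"
  show "prob_space (marginal J)"
    unfolding marginal_def by (rule prob_space.prob_space_distr) (auto intro: prob_space_measure_pmf)
qed

definition has_freq :: "(int \<Rightarrow> 'a) measure \<Rightarrow> bool" where
  "has_freq \<mu> \<longleftrightarrow> prob_space \<mu> \<and> sets \<mu> = sets (seqs UNIV) \<and>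
     (\<forall>t w. measure \<mu> {x. stake (length w) (hist t x) = w} = freq w)"

lemma exists_has_freq: "\<exists>\<mu>. has_freq \<mu>"
proof -
  interpret projective_family UNIV marginal "\<lambda>_. borel" by (rule projective_marginal)
  interpret Q: polish_projective UNIV marginal ..
  define \<phi> where "\<phi> \<omega> = (\<lambda>i. of_discrete (\<omega> i))" for \<omega> :: "int \<Rightarrow> 'a discrete"
  have of_discrete [measurable]: "(of_discrete :: 'a discrete \<Rightarrow> 'a) \<in> measurable borel (count_space UNIV)"
    by (auto intro!: measurableI borel_open open_discrete)
  have \<phi> [measurable]: "\<phi> \<in> measurable lim (seqs UNIV)"
    unfolding \<phi>_def seqs_def
  proof (rule measurable_PiM_single')
    fix i :: int
    have "(\<lambda>\<omega>. \<omega> i) \<in> measurable lim (borel :: 'a discrete measure)"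
      unfolding measurable_cong_sets[OF sets_lim refl] by (rule measurable_component_singleton) simp
    then show "(\<lambda>\<omega>. of_discrete (\<omega> i)) \<in> measurable lim (count_space UNIV)"
      by (rule measurable_compose) (rule of_discrete)
  qed auto
  define \<mu> where "\<mu> = distr lim (seqs UNIV) \<phi>"
  have prob: "prob_space \<mu>"
    unfolding \<mu>_def by (rule Q.P.prob_space_distr) (rule \<phi>)
  have "measure \<mu> {x. stake (length w) (hist t x) = w} = freq w" for t w
  proof (cases "w = []")
    case True
    then show ?thesis
      using prob_space.prob_space[OF prob] sum_freq[of 0] by (simp add: \<mu>_def)
  next
    case False
    define L where "L = length w"
    define J where "J = {t - int L..<t}"
    define k where "k = radius J"
    define X where "X = {f \<in> space (PiM J (\<lambda>_. borel :: 'a discrete measure)).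
        \<forall>j\<in>{..<L}. of_discrete (f (t - 1 - int j)) = w ! j}"
    have J: "finite J" "t - 1 \<in> J" "t - int L \<in> J" using False by (auto simp: J_def L_def)
    have k: "t \<le> int k" "- int k \<le> t - int L"
      using radius_bounds[OF J(1,2)] radius_bounds[OF J(1,3)] by (auto simp: k_def)
    have "Measurable.pred (PiM J (\<lambda>_. borel)) (\<lambda>f. of_discrete (f (t - 1 - int j)) = (w ! j))" if "j \<in> {..<L}" for j
    proof -
      have [measurable]: "(\<lambda>f. f (t - 1 - int j)) \<in> measurable (PiM J (\<lambda>_. borel :: 'a discrete measure)) borel"
        using that by (intro measurable_component_singleton) (auto simp: J_def)
      show ?thesis by measurable
    qed
    then have X: "X \<in> sets (PiM J (\<lambda>_. borel))"
      unfolding X_def by (intro sets.sets_Collect_finite_All) (auto simp: pred_def)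
    have cyl: "{x. stake L (hist t x) = w} = {x. \<forall>j\<in>{..<L}. x (t - 1 - int j) = w ! j}"
      by (auto simp: L_def list_eq_iff_nth_eq stake_nth)
    have meas: "{x. stake L (hist t x) = w} \<in> sets (seqs UNIV)"
      using cylinder_measurable[of t L UNIV "{w}"] by (simp add: sets_seqs_UNIV)
    have "measure \<mu> {x. stake L (hist t x) = w}
        = measure lim (\<phi> -` {x. stake L (hist t x) = w} \<inter> space lim)"
      unfolding \<mu>_def using meas by (rule measure_distr[OF \<phi>])
    also have "\<phi> -` {x. stake L (hist t x) = w} \<inter> space lim = emb UNIV J X"
      unfolding cyl by (auto simp: \<phi>_def X_def prod_emb_def space_PiM J_def)
    also have "measure lim (emb UNIV J X) = measure (marginal J) X"
      using X J(1) by (intro Q.measure_lim_emb) auto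
    also have "\<dots> = measure (block (2 * k)) (letters k J -` X)"
      unfolding marginal_def k_def using X by (subst measure_distr) auto
    also have "\<dots> = measure (block (2 * k)) {v. take L (drop (nat (int k - t)) v) = w}"
    proof (rule measure_eq_AE)
      show "AE v in block (2 * k). (v \<in> letters k J -` X) = (v \<in> {v. take L (drop (nat (int k - t)) v) = w})"
      proof (rule AE_pmfI)
        fix v assume "v \<in> set_pmf (block (2 * k))"
        then have len: "length v = 2 * k" using set_block by (auto simp: words_def)
        have "letters k J v \<in> X \<longleftrightarrow> (\<forall>j<L. v ! nat (int k - 1 - (t - 1 - int j)) = w ! j)"
          by (auto simp: X_def letters_def space_PiM J_def discrete_inverse)
        also have "\<dots> \<longleftrightarrow> (\<forall>j<L. v ! (nat (int k - t) + j) = w ! j)"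
        proof -
          have "nat (int k - 1 - (t - 1 - int j)) = nat (int k - t) + j" for j
            using k(1) by linarith
          then show ?thesis by (simp only:)
        qed
        also have "\<dots> \<longleftrightarrow> take L (drop (nat (int k - t)) v) = w"
          using k len by (auto simp: list_eq_iff_nth_eq L_def)
        finally show "(v \<in> letters k J -` X) = (v \<in> {v. take L (drop (nat (int k - t)) v) = w})" by simp
      qed
    qed auto
    also have "\<dots> = measure (map_pmf (\<lambda>v. take L (drop (nat (int k - t)) v)) (block (2 * k))) {w}"
      by (simp add: vimage_def)
    also have "map_pmf (\<lambda>v. take L (drop (nat (int k - t)) v)) (block (2 * k)) = block L"
    proof -
      have "2 * k = nat (int k - t) + (L + nat (int k + t - int L))" using k by linarith
      then show ?thesis using map_window_block by metis
    qed
    also have "measure (block L) {w} = freq w"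
      by (simp add: measure_block words_def L_def)
    finally show ?thesis by (simp add: L_def)
  qed
  then show ?thesis
    using prob by (auto simp: has_freq_def \<mu>_def)
qed

end

section \<open>Stationary processes compatible with a chain\<close>

abbreviation "streams_of \<equiv> stream_space (count_space (UNIV :: 'a::finite set))"

lemma measurable_hist:
  assumes "{..<t} \<subseteq> I"
  shows "hist t \<in> measurable (coord_algebra I) (streams_of :: 'a::finite stream measure)"
  using assms by (intro measurable_stream_space2) (auto intro!: measurable_coord)

lemma subalgebra_coord:
  assumes "sets \<mu> = sets (seqs UNIV)"
  shows "subalgebra \<mu> (coord_algebra I)"
proof -
  have "sets (coord_algebra I :: (int \<Rightarrow> 'a) measure) \<subseteq> sets (coord_algebra UNIV)"
    unfolding sets_coord_algebra by (rule sigma_sets_mono') auto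
  then show ?thesis
    using assms sets_eq_imp_space_eq[OF assms] by (simp add: subalgebra_def sets_seqs_UNIV)
qed

lemma stake_in_words: "stake n s \<in> words n"
  by (simp add: words_def)

lemma sum_words_delta:
  fixes f :: "'a::finite list \<Rightarrow> real"
  shows "(\<Sum>w\<in>words n. of_bool (stake n s = w) * f w) = f (stake n s)"
  using stake_in_words[of n s] by (simp add: of_bool_def if_distrib[of "\<lambda>x. x * _"] cong: if_cong)

lemma measurable_stake_pred [measurable]:
  "Measurable.pred streams_of (\<lambda>s :: 'a::finite stream. stake n s \<in> W)"
  by (rule measurable_compose[OF measurable_stake]) simp

lemma measurable_stake_eq [measurable]:
  "Measurable.pred streams_of (\<lambda>s :: 'a::finite stream. stake n s = w)"
  using measurable_stake_pred[of n "{w}"] by simp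

locale process = prob_space \<mu> for \<mu> :: "(int \<Rightarrow> 'a::finite) measure" +
  assumes sets_\<mu>: "sets \<mu> = sets (seqs UNIV)"
begin

lemma space_\<mu> [simp]: "space \<mu> = UNIV"
  using sets_eq_imp_space_eq[OF sets_\<mu>] by simp

lemma prob_UNIV [simp]: "measure \<mu> UNIV = 1"
  using prob_space by simp

lemma measurable_hist_\<mu> [measurable]: "hist t \<in> measurable \<mu> streams_of"
  unfolding measurable_cong_sets[OF sets_\<mu>[unfolded sets_seqs_UNIV] refl]
  by (rule measurable_hist) simp

lemma measurable_coord_\<mu> [measurable]: "(\<lambda>x. x i) \<in> measurable \<mu> (count_space UNIV)"
  unfolding measurable_cong_sets[OF sets_\<mu>[unfolded sets_seqs_UNIV] refl]
  by (rule measurable_coord) simp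

lemma measurable_shift_\<mu> [measurable]: "shift \<in> measurable \<mu> \<mu>"
proof -
  have "shift \<in> measurable \<mu> (seqs UNIV)"
    unfolding seqs_def by (rule measurable_PiM_single') (auto simp: shift_def)
  then show ?thesis by (simp cong: measurable_cong_sets add: sets_\<mu>)
qed

lemma coord_sets: "A \<in> sets (coord_algebra I) \<Longrightarrow> A \<in> sets \<mu>"
  using subalgebra_coord[OF sets_\<mu>, of I] by (auto simp: subalgebra_def)

sublocale sub: finite_measure_subalgebra \<mu> "coord_algebra I" for I
  by unfold_locales (rule subalgebra_coord[OF sets_\<mu>])

lemma integral_of_bool:
  assumes [measurable]: "Measurable.pred \<mu> P"
  shows "(\<integral>x. of_bool (P x) \<partial>\<mu>) = measure \<mu> {x. P x}"
proof -
  have "(\<integral>x. of_bool (P x) \<partial>\<mu>) = (\<integral>x. indicator {x \<in> space \<mu>. P x} x \<partial>\<mu>)"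
    by (intro Bochner_Integration.integral_cong) (auto simp: indicator_def)
  also have "\<dots> = measure \<mu> {x \<in> space \<mu>. P x}"
    by (subst Bochner_Integration.integral_indicator) (auto simp: emeasure_eq_measure)
  finally show ?thesis by simp
qed

lemma integrable_bounded:
  fixes f :: "(int \<Rightarrow> 'a) \<Rightarrow> real"
  assumes "f \<in> borel_measurable \<mu>" "\<And>x. \<bar>f x\<bar> \<le> B"
  shows "integrable \<mu> f"
  using assms by (intro integrable_const_bound[of _ B]) auto

lemma cylinder_approx:
  assumes "window_system \<tau> I" "A \<in> sets (coord_algebra I)" "0 < e"
  obtains C where "C \<in> cylinders \<tau>" "C \<in> sets \<mu>" "measure \<mu> (sym_diff A C) < e"
proof -
  have sub: "cylinders \<tau> \<subseteq> sets \<mu>"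
    using coord_sets sets_coord_algebra_cylinders[OF assms(1)] sigma_sets.Basic by blast
  have "\<exists>C\<in>cylinders \<tau>. measure \<mu> (sym_diff A C) < e"
  proof (rule algebra_approx[OF _ sub])
    show "algebra (space \<mu>) (cylinders \<tau>)" using algebra_cylinders[OF assms(1)] by simp
    show "A \<in> sigma_sets (space \<mu>) (cylinders \<tau>)"
      using assms(2) by (simp add: sets_coord_algebra_cylinders[OF assms(1)])
  qed fact
  then show thesis using that sub by blast
qed

text \<open>This turns an identity about words into the identity about all events of the past that defines a
  conditional expectation.\<close>

lemma zero_on_sigma_algebra:
  fixes d :: "(int \<Rightarrow> 'a) \<Rightarrow> real"
  assumes [measurable]: "d \<in> borel_measurable \<mu>" and d: "\<And>x. \<bar>d x\<bar> \<le> 1"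
    and win: "window_system \<tau> I"
    and zero: "\<And>C. C \<in> cylinders \<tau> \<Longrightarrow> (\<integral>x. indicator C x * d x \<partial>\<mu>) = 0"
    and A: "A \<in> sets (coord_algebra I)"
  shows "(\<integral>x. indicator A x * d x \<partial>\<mu>) = 0"
proof -
  have int: "integrable \<mu> (\<lambda>x. indicator B x * d x)" if [measurable]: "B \<in> sets \<mu>" for B
    by (rule integrable_bounded[of _ 1]) (auto simp: indicator_def d)
  have "\<bar>\<integral>x. indicator A x * d x \<partial>\<mu>\<bar> \<le> 0 + e" if e: "0 < e" for e
  proof -
    obtain C where C: "C \<in> cylinders \<tau>" "C \<in> sets \<mu>" "measure \<mu> (sym_diff A C) < e"
      using cylinder_approx[OF win A e] .
    have [measurable]: "A \<in> sets \<mu>" "C \<in> sets \<mu>"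
      using A C(2) coord_sets by auto
    have "\<bar>\<integral>x. indicator A x * d x \<partial>\<mu>\<bar> = \<bar>\<integral>x. indicator A x * d x - indicator C x * d x \<partial>\<mu>\<bar>"
      using int[of A] int[of C] zero[OF C(1)] by simp
    also have "\<dots> \<le> (\<integral>x. \<bar>indicator A x * d x - indicator C x * d x\<bar> \<partial>\<mu>)"
      by (rule integral_abs_bound)
    also have "\<dots> \<le> (\<integral>x. indicator (sym_diff A C) x \<partial>\<mu>)"
    proof (rule integral_mono)
      show "integrable \<mu> (\<lambda>x. \<bar>indicator A x * d x - indicator C x * d x\<bar>)"
        using int[of A] int[of C] by simp
      show "integrable \<mu> (indicator (sym_diff A C) :: _ \<Rightarrow> real)"
        by (rule integrable_bounded[of _ 1]) (auto simp: indicator_def)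
      show "\<bar>indicator A x * d x - indicator C x * d x\<bar> \<le> indicator (sym_diff A C) x" for x
        using d[of x] by (auto simp: indicator_def)
    qed
    also have "\<dots> = measure \<mu> (sym_diff A C)"
      by (subst Bochner_Integration.integral_indicator) (auto simp: emeasure_eq_measure)
    finally show ?thesis using C(3) by simp
  qed
  then show ?thesis using field_le_epsilon[of "\<bar>\<integral>x. indicator A x * d x \<partial>\<mu>\<bar>" 0] by simp
qed

end

context chain
begin

text \<open>The measures in \<^const>\<open>invariant_compatible\<close>, in terms of the transition probabilities \<open>G\<close>.\<close>

definition compatible :: "(int \<Rightarrow> 'a) measure \<Rightarrow> bool" where
  "compatible \<mu> \<longleftrightarrow> prob_space \<mu> \<and> sets \<mu> = sets (seqs UNIV) \<and> distr \<mu> \<mu> shift = \<mu> \<and>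
     (\<forall>a. AE x in \<mu>. real_cond_exp \<mu> (coord_algebra {..-1}) (indicator {x. x 0 = a}) x = G (hist 0 x) a)"

lemma has_freq_process: "has_freq \<mu> \<Longrightarrow> process \<mu>"
  by (simp add: has_freq_def process_def process_axioms_def)

lemma has_freq_word: "has_freq \<mu> \<Longrightarrow> measure \<mu> {x. stake (length w) (hist t x) = w} = freq w"
  by (simp add: has_freq_def)

lemma has_freq_cylinder:
  assumes "has_freq \<mu>"
  shows "measure \<mu> {x. stake L (hist t x) \<in> W} = (\<Sum>w\<in>words L \<inter> W. freq w)"
proof -
  interpret process \<mu> by (rule has_freq_process) fact
  have "{x. stake L (hist t x) \<in> W} = (\<Union>w\<in>words L \<inter> W. {x. stake L (hist t x) = w})"
    by (auto simp: words_def)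
  moreover have "{x. stake L (hist t x) = w} \<in> sets \<mu>" for w
    using measurable_sets[of "\<lambda>x. stake L (hist t x)" \<mu> "count_space UNIV" "{w}"] by (simp add: vimage_def)
  ultimately have "measure \<mu> {x. stake L (hist t x) \<in> W} = (\<Sum>w\<in>words L \<inter> W. measure \<mu> {x. stake L (hist t x) = w})"
    by (simp only:) (rule finite_measure_finite_Union, auto simp: disjoint_family_on_def)
  also have "\<dots> = (\<Sum>w\<in>words L \<inter> W. freq w)"
    using has_freq_word[OF assms] by (intro sum.cong) (auto simp: words_def)
  finally show ?thesis .
qed

text \<open>The cylinders over symmetric windows are stable under intersections and generate.\<close>

lemma has_freq_unique:
  assumes "has_freq \<mu>" "has_freq \<nu>"
  shows "\<mu> = \<nu>"
proof -
  interpret process \<mu> by (rule has_freq_process) fact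
  interpret \<nu>: process \<nu> by (rule has_freq_process) fact
  let ?C = "cylinders (\<lambda>L. int (L div 2)) :: (int \<Rightarrow> 'a) set set"
  have gen: "sets (seqs UNIV) = sigma_sets UNIV ?C"
    unfolding sets_seqs_UNIV by (rule sets_coord_algebra_cylinders[OF window_system_all])
  interpret algebra UNIV ?C by (rule algebra_cylinders[OF window_system_all])
  show ?thesis
  proof (rule measure_eqI_generator_eq[where E = ?C and \<Omega> = UNIV and A = "\<lambda>_. UNIV"])
    show "emeasure \<mu> X = emeasure \<nu> X" if "X \<in> ?C" for X
      using that has_freq_cylinder[OF assms(1)] has_freq_cylinder[OF assms(2)]
      by (auto simp: cylinders_def emeasure_eq_measure \<nu>.emeasure_eq_measure)
  qed (auto simp: Int_stable_def sets_\<mu> \<nu>.sets_\<mu> gen emeasure_eq_measure)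
qed

end

text \<open>The process with the limiting frequencies is compatible with \<open>G\<close>. As \<open>G\<close> need not be
  continuous, this does not follow from a passage to the limit alone. Continuity is replaced by the
  fact that the transition probability is a function of the last \<open>k\<close> letters unless these form an
  undetermined word, and the probability of this tends to \<open>0\<close>.\<close>

locale freq_process = chain G \<epsilon> M + process \<mu>
  for G :: "'a::finite stream \<Rightarrow> 'a \<Rightarrow> real" and \<epsilon> M :: real and \<mu> :: "(int \<Rightarrow> 'a) measure" +
  assumes has_freq_\<mu>: "has_freq \<mu>"
begin

lemma shift_invariant: "distr \<mu> \<mu> shift = \<mu>"
proof (rule has_freq_unique)
  show "has_freq (distr \<mu> \<mu> shift)"
    unfolding has_freq_def
  proof (intro conjI allI)
    show "prob_space (distr \<mu> \<mu> shift)" by (rule prob_space_distr) measurable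
    fix t w
    have "{x \<in> space \<mu>. stake (length w) (hist t x) = w} \<in> sets \<mu>" by measurable
    then have "measure (distr \<mu> \<mu> shift) {x. stake (length w) (hist t x) = w}
        = measure \<mu> {x. stake (length w) (hist t (shift x)) = w}"
      by (subst measure_distr) (auto simp: vimage_def)
    then show "measure (distr \<mu> \<mu> shift) {x. stake (length w) (hist t x) = w} = freq w"
      using has_freq_word[OF has_freq_\<mu>] by (simp add: hist_shift)
  qed (simp add: sets_\<mu>)
qed (rule has_freq_\<mu>)

lemma integral_block:
  fixes f :: "'a list \<Rightarrow> real"
  shows "(\<integral>x. f (stake k (hist 0 x)) \<partial>\<mu>) = (\<Sum>v\<in>words k. freq v * f v)"
proof -
  have "(\<integral>x. f (stake k (hist 0 x)) \<partial>\<mu>)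
      = (\<integral>x. (\<Sum>v\<in>words k. of_bool (stake k (hist 0 x) = v) * f v) \<partial>\<mu>)"
    by (simp only: sum_words_delta)
  also have "\<dots> = (\<Sum>v\<in>words k. \<integral>x. of_bool (stake k (hist 0 x) = v) * f v \<partial>\<mu>)"
    by (intro Bochner_Integration.integral_sum integrable_mult_left integrable_bounded[of _ 1]) auto
  also have "\<dots> = (\<Sum>v\<in>words k. freq v * f v)"
  proof (rule sum.cong)
    fix v :: "'a list" assume v: "v \<in> words k"
    have "(\<integral>x. of_bool (stake k (hist 0 x) = v) * f v \<partial>\<mu>)
        = (\<integral>x. of_bool (stake k (hist 0 x) = v) \<partial>\<mu>) * f v"
      by (rule Bochner_Integration.integral_mult_left_zero)
    also have "(\<integral>x. of_bool (stake k (hist 0 x) = v) \<partial>\<mu>) = measure \<mu> {x. stake k (hist 0 x) = v}"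
      by (rule integral_of_bool) measurable
    also have "\<dots> = freq v"
      using v has_freq_word[OF has_freq_\<mu>, of v 0] by (simp add: words_def)
    finally show "(\<integral>x. of_bool (stake k (hist 0 x) = v) * f v \<partial>\<mu>) = freq v * f v" .
  qed simp
  finally show ?thesis .
qed

lemma integral_word_letter:
  "(\<integral>x. of_bool (stake (length w) (hist 0 x) = w) * of_bool (x 0 = a) \<partial>\<mu>) = freq (a # w)"
proof -
  have "(\<integral>x. of_bool (stake (length w) (hist 0 x) = w \<and> x 0 = a) \<partial>\<mu>)
      = measure \<mu> {x. stake (length w) (hist 0 x) = w \<and> x 0 = a}"
    by (rule integral_of_bool) measurable
  also have "{x. stake (length w) (hist 0 x) = w \<and> x 0 = a}
      = {x. stake (length (a # w)) (hist 1 x) = a # w}"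
    by (auto simp: hist_step[of 0, simplified])
  finally show ?thesis
    using has_freq_word[OF has_freq_\<mu>, of "a # w" 1] by (simp only: of_bool_conj)
qed

text \<open>Compatibility means that \<open>surprise a\<close> is orthogonal to the past.\<close>

definition surprise :: "'a \<Rightarrow> (int \<Rightarrow> 'a) \<Rightarrow> real" where
  "surprise a x = of_bool (x 0 = a) - G (hist 0 x) a"

lemma surprise_measurable [measurable]: "surprise a \<in> borel_measurable \<mu>"
  unfolding surprise_def by measurable

lemma abs_surprise: "\<bar>surprise a x\<bar> \<le> 1"
  using G_abs[of "hist 0 x" a] G_nonneg[of "hist 0 x" a] by (auto simp: surprise_def)

text \<open>Replace the past beyond the last \<open>k\<close> letters by \<open>origin\<close>, which turns the transition
  probability into a function of a block. Both the true process and the finite chains of which it is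
  the limit change by at most the probability of an undetermined word, hence the factor \<open>2\<close>.\<close>

lemma integral_word_surprise_le:
  assumes k: "length w \<le> k"
  shows "\<bar>\<integral>x. of_bool (stake (length w) (hist 0 x) = w) * surprise a x \<partial>\<mu>\<bar>
    \<le> 2 * (real (card (undetermined G k)) * M ^ k)"
proof -
  let ?w = "\<lambda>x. of_bool (stake (length w) (hist 0 x) = w) :: real"
  let ?U = "real (card (undetermined G k)) * M ^ k"
  let ?v = "\<lambda>x. stake k (hist 0 x)"
  let ?g = "\<lambda>v. of_bool (take (length w) v = w) * G (v @- origin) a"
  have [measurable]: "(\<lambda>x. ?g (?v x)) \<in> borel_measurable \<mu>"
    by (rule measurable_compose[OF measurable_compose[OF measurable_hist_\<mu> measurable_stake]]) simp
  have gv: "?g (?v x) = ?w x * G (?v x @- origin) a" for x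
    using k by (simp add: take_stake min_absorb1)
  have int: "integrable \<mu> (\<lambda>x. ?g (?v x))" "integrable \<mu> (\<lambda>x. ?w x * G (hist 0 x) a)"
    "integrable \<mu> (\<lambda>x. ?w x * of_bool (x 0 = a))"
    using G_abs by (intro integrable_bounded[of _ 1]; auto simp: abs_mult)+
  have 1: "\<bar>(\<integral>x. ?w x * of_bool (x 0 = a) \<partial>\<mu>) - (\<integral>x. ?g (?v x) \<partial>\<mu>)\<bar> \<le> ?U"
    using freq_Cons_approx[OF k, of a origin] by (simp only: integral_word_letter integral_block[of ?g k])
  have "\<bar>(\<integral>x. ?g (?v x) \<partial>\<mu>) - (\<integral>x. ?w x * G (hist 0 x) a \<partial>\<mu>)\<bar>
      = \<bar>\<integral>x. ?g (?v x) - ?w x * G (hist 0 x) a \<partial>\<mu>\<bar>"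
    using int by simp
  also have "\<dots> \<le> (\<integral>x. \<bar>?g (?v x) - ?w x * G (hist 0 x) a\<bar> \<partial>\<mu>)"
    by (rule integral_abs_bound)
  also have "\<dots> \<le> (\<integral>x. of_bool (?v x \<in> undetermined G k) \<partial>\<mu>)"
  proof (rule integral_mono)
    show "integrable \<mu> (\<lambda>x. \<bar>?g (?v x) - ?w x * G (hist 0 x) a\<bar>)" using int by simp
    show "integrable \<mu> (\<lambda>x. of_bool (?v x \<in> undetermined G k) :: real)"
      by (rule integrable_bounded[of _ 1]) auto
    fix x
    show "\<bar>?g (?v x) - ?w x * G (hist 0 x) a\<bar> \<le> of_bool (?v x \<in> undetermined G k)"
    proof (cases "?v x \<in> undetermined G k")
      case False
      then have "G (?v x @- origin) a = G (?v x @- sdrop k (hist 0 x)) a"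
        unfolding undetermined_def by (auto simp: words_def)
      then show ?thesis unfolding gv by (simp add: stake_sdrop)
    next
      case True
      then show ?thesis
        unfolding gv using G_abs[of "?v x @- origin" a] G_abs[of "hist 0 x" a]
          G_nonneg[of "?v x @- origin" a] G_nonneg[of "hist 0 x" a]
        by (auto simp: of_bool_def abs_le_iff)
    qed
  qed
  also have "\<dots> = (\<Sum>v\<in>undetermined G k. freq v)"
    unfolding integral_block[of "\<lambda>v. of_bool (v \<in> undetermined G k)"]
    by (intro sum.mono_neutral_cong_right) (auto simp: undetermined_def)
  also have "\<dots> \<le> ?U"
    by (rule sum_freq_undetermined)
  finally have 2: "\<bar>(\<integral>x. ?g (?v x) \<partial>\<mu>) - (\<integral>x. ?w x * G (hist 0 x) a \<partial>\<mu>)\<bar> \<le> ?U" .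
  have "(\<integral>x. ?w x * surprise a x \<partial>\<mu>)
      = (\<integral>x. ?w x * of_bool (x 0 = a) \<partial>\<mu>) - (\<integral>x. ?w x * G (hist 0 x) a \<partial>\<mu>)"
    unfolding surprise_def right_diff_distrib using int by (intro Bochner_Integration.integral_diff)
  then show ?thesis using 1 2 by linarith
qed

lemma integral_word_surprise:
  "(\<integral>x. of_bool (stake (length w) (hist 0 x) = w) * surprise a x \<partial>\<mu>) = 0"
proof -
  have "\<bar>\<integral>x. of_bool (stake (length w) (hist 0 x) = w) * surprise a x \<partial>\<mu>\<bar> \<le> 0"
  proof (rule LIMSEQ_le_const)
    show "(\<lambda>k. 2 * (real (card (undetermined G k)) * M ^ k)) \<longlonglongrightarrow> 0"
      using tendsto_mult_right_zero[OF undetermined_LIMSEQ] .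
  qed (use integral_word_surprise_le in blast)
  then show ?thesis by simp
qed

lemma integral_past_surprise:
  assumes A: "A \<in> sets (coord_algebra {..-1})"
  shows "(\<integral>x. indicator A x * surprise a x \<partial>\<mu>) = 0"
proof (rule zero_on_sigma_algebra[OF _ abs_surprise window_system_past[of 0, simplified] _ A])
  fix C :: "(int \<Rightarrow> 'a) set" assume cyl: "C \<in> cylinders (\<lambda>_. 0)"
  obtain L W where C: "C = {x. stake L (hist 0 x) \<in> W}" using cyl by (auto simp: cylinders_def)
  have "indicator C x * surprise a x
      = (\<Sum>w\<in>words L. of_bool (stake L (hist 0 x) = w) * (of_bool (w \<in> W) * surprise a x))" for x
    unfolding sum_words_delta by (simp add: C indicator_def)
  then have "(\<integral>x. indicator C x * surprise a x \<partial>\<mu>)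
      = (\<integral>x. (\<Sum>w\<in>words L. of_bool (stake L (hist 0 x) = w) * (of_bool (w \<in> W) * surprise a x)) \<partial>\<mu>)"
    by (simp only:)
  also have "\<dots> = (\<Sum>w\<in>words L. \<integral>x. of_bool (stake L (hist 0 x) = w) * (of_bool (w \<in> W) * surprise a x) \<partial>\<mu>)"
    using abs_surprise
    by (intro Bochner_Integration.integral_sum integrable_bounded[of _ 1]) (auto simp: abs_mult)
  also have "\<dots> = (\<Sum>w\<in>words L. of_bool (w \<in> W) * (\<integral>x. of_bool (stake L (hist 0 x) = w) * surprise a x \<partial>\<mu>))"
    by (simp only: mult.left_commute[of "of_bool (stake L _ = _)"] Bochner_Integration.integral_mult_right_zero)
  also have "\<dots> = 0"
    using integral_word_surprise by (intro sum.neutral) (auto simp: words_def)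
  finally show "(\<integral>x. indicator C x * surprise a x \<partial>\<mu>) = 0" .
qed measurable

theorem compatible_\<mu>: "compatible \<mu>"
proof -
  have "AE x in \<mu>. real_cond_exp \<mu> (coord_algebra {..-1}) (indicator {x. x 0 = a}) x = G (hist 0 x) a" for a
  proof (rule sub.real_cond_exp_charact)
    have ind: "(indicator {x. x 0 = a} :: _ \<Rightarrow> real) = (\<lambda>x. of_bool (x 0 = a))"
      by (auto simp: indicator_def)
    show "integrable \<mu> (indicator {x. x 0 = a} :: _ \<Rightarrow> real)"
      unfolding ind by (intro integrable_bounded[of _ 1]) auto
    show "integrable \<mu> (\<lambda>x. G (hist 0 x) a)"
      using G_abs by (intro integrable_bounded[of _ 1]) auto
    show "(\<lambda>x. G (hist 0 x) a) \<in> borel_measurable (coord_algebra {..-1})"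
      by (rule measurable_compose[OF measurable_hist G_measurable]) auto
    fix A :: "(int \<Rightarrow> 'a) set" assume A: "A \<in> sets (coord_algebra {..-1})"
    have [measurable]: "A \<in> sets \<mu>" using A by (rule coord_sets)
    have "(\<integral>x. indicator A x * surprise a x \<partial>\<mu>)
        = (\<integral>x. indicator A x * of_bool (x 0 = a) \<partial>\<mu>) - (\<integral>x. indicator A x * G (hist 0 x) a \<partial>\<mu>)"
      unfolding surprise_def right_diff_distrib using G_abs
      by (intro Bochner_Integration.integral_diff integrable_bounded[of _ 1])
         (auto simp: indicator_def)
    then show "(\<integral>x\<in>A. indicator {x. x 0 = a} x \<partial>\<mu>) = (\<integral>x\<in>A. G (hist 0 x) a \<partial>\<mu>)"
      using integral_past_surprise[OF A, of a] by (simp add: set_lebesgue_integral_def ind)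
  qed
  then show ?thesis
    using shift_invariant prob_space_axioms by (simp add: compatible_def sets_\<mu>)
qed

end

section \<open>Compatible measures forget their past\<close>

text \<open>Conversely, a compatible measure has the limiting word frequencies: given its past, it evolves
  like the chain, and the chain forgets where it started.\<close>

locale compatible_process = chain G \<epsilon> M + process \<mu>
  for G :: "'a::finite stream \<Rightarrow> 'a \<Rightarrow> real" and \<epsilon> M :: real and \<mu> :: "(int \<Rightarrow> 'a) measure" +
  assumes compatible_\<mu>: "compatible \<mu>"
begin

lemma integral_next_letter:
  assumes [measurable]: "h \<in> borel_measurable streams_of" and h: "\<And>s. \<bar>h s\<bar> \<le> 1"
  shows "(\<integral>x. h (hist 0 x) * of_bool (x 0 = a) \<partial>\<mu>) = (\<integral>x. h (hist 0 x) * G (hist 0 x) a \<partial>\<mu>)"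
proof -
  have ind: "(indicator {x. x 0 = a} :: _ \<Rightarrow> real) = (\<lambda>x. of_bool (x 0 = a))"
    by (auto simp: indicator_def)
  have "(\<integral>x. h (hist 0 x) * of_bool (x 0 = a) \<partial>\<mu>)
      = (\<integral>x. h (hist 0 x) * real_cond_exp \<mu> (coord_algebra {..-1}) (indicator {x. x 0 = a}) x \<partial>\<mu>)"
  proof (subst sub.real_cond_exp_intg(2))
    show "integrable \<mu> (\<lambda>x. h (hist 0 x) * indicator {x. x 0 = a} x)"
      unfolding ind using h by (intro integrable_bounded[of _ 1]) (auto simp: abs_mult)
    show "(\<lambda>x. h (hist 0 x)) \<in> borel_measurable (coord_algebra {..-1})"
      by (rule measurable_compose[OF measurable_hist assms(1)]) auto
    show "(indicator {x. x 0 = a} :: _ \<Rightarrow> real) \<in> borel_measurable \<mu>"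
      unfolding ind by measurable
  qed (simp add: ind)
  also have "\<dots> = (\<integral>x. h (hist 0 x) * G (hist 0 x) a \<partial>\<mu>)"
  proof (rule integral_cong_AE)
    have "AE x in \<mu>. real_cond_exp \<mu> (coord_algebra {..-1}) (indicator {x. x 0 = a}) x = G (hist 0 x) a"
      using compatible_\<mu> by (simp add: compatible_def)
    then show "AE x in \<mu>. h (hist 0 x) * real_cond_exp \<mu> (coord_algebra {..-1}) (indicator {x. x 0 = a}) x
        = h (hist 0 x) * G (hist 0 x) a"
      by eventually_elim simp
  qed auto
  finally show ?thesis .
qed

lemma integral_shift:
  fixes f :: "(int \<Rightarrow> 'a) \<Rightarrow> real"
  assumes "f \<in> borel_measurable \<mu>"
  shows "(\<integral>x. f (shift x) \<partial>\<mu>) = (\<integral>x. f x \<partial>\<mu>)"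
proof -
  have "(\<integral>x. f x \<partial>distr \<mu> \<mu> shift) = (\<integral>x. f (shift x) \<partial>\<mu>)"
    by (rule integral_distr) (auto intro: assms)
  then show ?thesis using compatible_\<mu> by (simp add: compatible_def)
qed

lemma integral_hist:
  fixes h :: "'a stream \<Rightarrow> real"
  assumes [measurable]: "h \<in> borel_measurable streams_of"
  shows "(\<integral>x. h (hist t x) \<partial>\<mu>) = (\<integral>x. h (hist 0 x) \<partial>\<mu>)"
proof -
  have step: "(\<integral>x. h (hist (t + 1) x) \<partial>\<mu>) = (\<integral>x. h (hist t x) \<partial>\<mu>)" for t
    using integral_shift[of "\<lambda>x. h (hist t x)"] by (simp add: hist_shift)
  show ?thesis
  proof (induction t rule: int_induct[where k = 0])
    case (step2 i)
    then show ?case using step[of "i - 1"] by simp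
  qed (simp_all add: step)
qed

lemma measure_hist:
  assumes [measurable]: "Measurable.pred streams_of P"
  shows "measure \<mu> {x. P (hist t x)} = measure \<mu> {x. P (hist 0 x)}"
  using integral_hist[of "\<lambda>s. of_bool (P s)" t] by (simp add: integral_of_bool)

lemma measurable_shift_word [measurable]: "(\<lambda>s. w @- s) \<in> measurable streams_of streams_of"
  by (induction w) auto

lemma measurable_G_word [measurable]: "(\<lambda>s. G (w @- s) a) \<in> borel_measurable streams_of"
  by (rule measurable_compose[OF measurable_shift_word G_measurable])

lemma measurable_word_prob [measurable]: "(\<lambda>s. word_prob s w) \<in> borel_measurable streams_of"
  by (induction w) auto

text \<open>The Markov property for words: conditionally on the past before \<open>w\<close>, the probability of \<open>w\<close> is
  \<^const>\<open>word_prob\<close>. The word grows at its newest end, one application of compatibility per letter;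
  invariance moves the observation time back to \<open>0\<close>.\<close>

lemma integral_word:
  assumes [measurable]: "h \<in> borel_measurable streams_of" and h: "\<And>s. \<bar>h s\<bar> \<le> 1"
  shows "(\<integral>x. h (sdrop (length w) (hist 0 x)) * of_bool (stake (length w) (hist 0 x) = w) \<partial>\<mu>)
    = (\<integral>x. h (hist 0 x) * word_prob (hist 0 x) w \<partial>\<mu>)"
  using assms
proof (induction w arbitrary: h)
  case (Cons a w)
  note [measurable] = Cons.prems(1)
  let ?w = "\<lambda>s. of_bool (stake (length w) s = w) :: real"
  have "(\<integral>x. h (sdrop (length (a # w)) (hist 0 x)) * of_bool (stake (length (a # w)) (hist 0 x) = a # w) \<partial>\<mu>)
      = (\<integral>x. h (sdrop (length (a # w)) (hist 1 x)) * of_bool (stake (length (a # w)) (hist 1 x) = a # w) \<partial>\<mu>)"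
    by (rule integral_hist[symmetric]) measurable
  also have "\<dots> = (\<integral>x. h (sdrop (length w) (hist 0 x)) * ?w (hist 0 x) * of_bool (x 0 = a) \<partial>\<mu>)"
    by (intro Bochner_Integration.integral_cong) (auto simp: hist_step[of 0, simplified])
  also have "\<dots> = (\<integral>x. h (sdrop (length w) (hist 0 x)) * ?w (hist 0 x) * G (hist 0 x) a \<partial>\<mu>)"
    using Cons.prems(2)
    by (intro integral_next_letter[of "\<lambda>s. h (sdrop (length w) s) * ?w s" a]) (auto simp: abs_mult)
  also have "\<dots> = (\<integral>x. (h (sdrop (length w) (hist 0 x)) * G (w @- sdrop (length w) (hist 0 x)) a) * ?w (hist 0 x) \<partial>\<mu>)"
  proof (intro Bochner_Integration.integral_cong refl)
    fix x :: "int \<Rightarrow> 'a"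
    show "h (sdrop (length w) (hist 0 x)) * ?w (hist 0 x) * G (hist 0 x) a
        = h (sdrop (length w) (hist 0 x)) * G (w @- sdrop (length w) (hist 0 x)) a * ?w (hist 0 x)"
      using stake_sdrop[of "length w" "hist 0 x"] by (auto simp: of_bool_def)
  qed
  also have "\<dots> = (\<integral>x. h (hist 0 x) * G (w @- hist 0 x) a * word_prob (hist 0 x) w \<partial>\<mu>)"
  proof (rule Cons.IH)
    show "\<bar>h s * G (w @- s) a\<bar> \<le> 1" for s
      using mult_mono[OF Cons.prems(2)[of s] G_abs[of "w @- s" a]] by (simp add: abs_mult)
  qed measurable
  finally show ?case by (simp add: mult.assoc mult.commute[of "G _ _"])
qed simp

lemma integral_expect:
  assumes [measurable]: "h \<in> borel_measurable streams_of" and h: "\<And>s. \<bar>h s\<bar> \<le> 1"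
  shows "(\<integral>x. h (sdrop n (hist 0 x)) * f (stake n (hist 0 x)) \<partial>\<mu>) = (\<integral>x. h (hist 0 x) * expect n (hist 0 x) f \<partial>\<mu>)"
proof -
  have "h (sdrop n (hist 0 x)) * f (stake n (hist 0 x))
      = (\<Sum>w\<in>words n. (h (sdrop (length w) (hist 0 x)) * of_bool (stake (length w) (hist 0 x) = w)) * f w)" for x
  proof -
    have "h (sdrop n (hist 0 x)) * f (stake n (hist 0 x))
        = (\<Sum>w\<in>words n. of_bool (stake n (hist 0 x) = w) * (h (sdrop n (hist 0 x)) * f w))"
      by (rule sum_words_delta[symmetric])
    also have "\<dots> = (\<Sum>w\<in>words n. (h (sdrop (length w) (hist 0 x)) * of_bool (stake (length w) (hist 0 x) = w)) * f w)"
      by (intro sum.cong) (auto simp: words_def)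
    finally show ?thesis .
  qed
  then have "(\<integral>x. h (sdrop n (hist 0 x)) * f (stake n (hist 0 x)) \<partial>\<mu>)
      = (\<integral>x. (\<Sum>w\<in>words n. (h (sdrop (length w) (hist 0 x)) * of_bool (stake (length w) (hist 0 x) = w)) * f w) \<partial>\<mu>)"
    by (simp only:)
  also have "\<dots> = (\<Sum>w\<in>words n. \<integral>x. (h (sdrop (length w) (hist 0 x)) * of_bool (stake (length w) (hist 0 x) = w)) * f w \<partial>\<mu>)"
    using h by (intro Bochner_Integration.integral_sum integrable_mult_left integrable_bounded[of _ 1]) (auto simp: abs_mult)
  also have "\<dots> = (\<Sum>w\<in>words n. \<integral>x. h (hist 0 x) * word_prob (hist 0 x) w * f w \<partial>\<mu>)"
    by (simp only: Bochner_Integration.integral_mult_left_zero integral_word[OF assms])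
  also have "\<dots> = (\<integral>x. (\<Sum>w\<in>words n. h (hist 0 x) * word_prob (hist 0 x) w * f w) \<partial>\<mu>)"
  proof (intro Bochner_Integration.integral_sum[symmetric] integrable_mult_left integrable_bounded[of _ 1])
    fix x and w :: "'a list"
    have "word_prob (hist 0 x) w \<le> (\<Sum>v\<in>words (length w). word_prob (hist 0 x) v)"
      by (rule member_le_sum) (auto simp: in_words word_prob_nonneg)
    then have "\<bar>word_prob (hist 0 x) w\<bar> \<le> 1"
      by (simp add: sum_word_prob word_prob_nonneg)
    then show "\<bar>h (hist 0 x) * word_prob (hist 0 x) w\<bar> \<le> 1"
      using mult_mono[OF h[of "hist 0 x"], of "\<bar>word_prob (hist 0 x) w\<bar>" 1] by (simp add: abs_mult)
  qed measurable
  also have "\<dots> = (\<integral>x. h (hist 0 x) * expect n (hist 0 x) f \<partial>\<mu>)"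
    by (simp add: expect_def sum_distrib_left mult.assoc)
  finally show ?thesis .
qed

text \<open>Averaging the uniform estimate over the past decouples any event of the past from the
  next block.\<close>

lemma decoupling:
  assumes m: "forgets m c" and [measurable]: "h \<in> borel_measurable streams_of"
    and h: "\<And>s. 0 \<le> h s \<and> h s \<le> 1" and f: "\<And>w. 0 \<le> f w \<and> f w \<le> 1" and n: "m + L \<le> n"
  shows "\<bar>(\<integral>x. h (sdrop n (hist 0 x)) * f (stake L (hist 0 x)) \<partial>\<mu>)
      - (\<integral>x. h (hist 0 x) \<partial>\<mu>) * (\<Sum>w\<in>words L. freq w * f w)\<bar> \<le> c * (\<integral>x. h (hist 0 x) \<partial>\<mu>)"
proof -
  let ?p = "\<Sum>w\<in>words L. freq w * f w"
  let ?e = "\<lambda>x. expect n (hist 0 x) (\<lambda>w. f (take L w))"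
  have h1: "\<bar>h s\<bar> \<le> 1" for s using h[of s] by simp
  have e: "0 \<le> ?e x \<and> ?e x \<le> 1" for x using f by (rule expect_unit)
  have [measurable]: "?e \<in> borel_measurable \<mu>"
    unfolding expect_def by measurable
  have int: "integrable \<mu> (\<lambda>x. h (hist 0 x))" using h1 by (intro integrable_bounded[of _ 1]) auto
  have inte: "integrable \<mu> (\<lambda>x. h (hist 0 x) * ?e x)"
  proof (rule integrable_bounded[of _ 1])
    show "\<bar>h (hist 0 x) * ?e x\<bar> \<le> 1" for x
      using mult_mono[of "h (hist 0 x)" 1 "?e x" 1] h[of "hist 0 x"] e[of x] by (simp add: abs_mult)
  qed measurable
  have take: "f (stake L s) = f (take L (stake n s))" for s
    using n by (simp add: take_stake min_absorb1)
  have "\<bar>(\<integral>x. h (sdrop n (hist 0 x)) * f (stake L (hist 0 x)) \<partial>\<mu>) - (\<integral>x. h (hist 0 x) \<partial>\<mu>) * ?p\<bar>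
      = \<bar>(\<integral>x. h (hist 0 x) * ?e x \<partial>\<mu>) - (\<integral>x. h (hist 0 x) * ?p \<partial>\<mu>)\<bar>"
    unfolding take integral_expect[OF assms(2) h1, of n "\<lambda>w. f (take L w)"] by simp
  also have "\<dots> = \<bar>\<integral>x. h (hist 0 x) * ?e x - h (hist 0 x) * ?p \<partial>\<mu>\<bar>"
    using int inte by simp
  also have "\<dots> \<le> (\<integral>x. \<bar>h (hist 0 x) * ?e x - h (hist 0 x) * ?p\<bar> \<partial>\<mu>)"
    by (rule integral_abs_bound)
  also have "\<dots> \<le> (\<integral>x. c * h (hist 0 x) \<partial>\<mu>)"
  proof (rule integral_mono)
    show "integrable \<mu> (\<lambda>x. \<bar>h (hist 0 x) * ?e x - h (hist 0 x) * ?p\<bar>)" using int inte by simp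
    show "integrable \<mu> (\<lambda>x. c * h (hist 0 x))" using int by simp
    fix x
    have "\<bar>h (hist 0 x) * ?e x - h (hist 0 x) * ?p\<bar> = h (hist 0 x) * \<bar>?e x - ?p\<bar>"
      using h[of "hist 0 x"] by (simp add: abs_mult right_diff_distrib[symmetric])
    also have "\<dots> \<le> h (hist 0 x) * c"
      using h[of "hist 0 x"] forgets_freq[OF m f n] by (intro mult_left_mono) auto
    finally show "\<bar>h (hist 0 x) * ?e x - h (hist 0 x) * ?p\<bar> \<le> c * h (hist 0 x)" by (simp add: mult.commute)
  qed
  finally show ?thesis by simp
qed

text \<open>Decoupling with the trivial event of the past, for an arbitrarily long gap.\<close>

theorem has_freq_\<mu>: "has_freq \<mu>"
  unfolding has_freq_def
proof (intro conjI allI)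
  fix t and w :: "'a list"
  have sum: "(\<Sum>v\<in>words (length w). freq v * of_bool (v = w)) = freq w"
    using in_words[of w] by (simp add: of_bool_def if_distrib cong: if_cong)
  have "\<bar>measure \<mu> {x. stake (length w) (hist 0 x) = w} - freq w\<bar> \<le> 0 + c" if c: "0 < c" for c
  proof -
    obtain m where "forgets m c" using uniform_forgetting[OF c] .
    from decoupling[OF this, of "\<lambda>_. 1" "\<lambda>v. of_bool (v = w)" "length w" "m + length w"]
    show ?thesis
      by (simp only: sum) (simp add: integral_of_bool prob_space)
  qed
  then have "measure \<mu> {x. stake (length w) (hist 0 x) = w} = freq w"
    using field_le_epsilon[of "\<bar>measure \<mu> {x. stake (length w) (hist 0 x) = w} - freq w\<bar>" 0] by simp
  then show "measure \<mu> {x. stake (length w) (hist t x) = w} = freq w"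
    using measure_hist[of "\<lambda>s. stake (length w) s = w" t] by simp
qed (simp_all add: prob_space_axioms sets_\<mu>)

section \<open>Absolute regularity\<close>

text \<open>The block of \<open>B\<close> is moved to end at time \<open>0\<close>; the \<open>n\<close> letters newer than those of \<open>A\<close> are then
  those of \<open>B\<close> and the gap of \<open>N - 1\<close> letters. The bound is proportional to the measure of \<open>A\<close>,
  which is what makes it summable over partitions.\<close>

lemma mixing_cylinders:
  assumes m: "forgets m c" and N: "m < N"
    and A: "A \<in> cylinders (\<lambda>_. 1)" and B: "B \<in> cylinders (\<lambda>L. int (N + L))"
  shows "\<bar>measure \<mu> (A \<inter> B) - measure \<mu> A * measure \<mu> B\<bar> \<le> c * measure \<mu> A"
proof -
  obtain K W where A': "A = {x. stake K (hist 1 x) \<in> W}" using A by (auto simp: cylinders_def)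
  obtain L V where B': "B = {x. stake L (hist (int (N + L)) x) \<in> V}" using B by (auto simp: cylinders_def)
  define n where "n = N + L - 1"
  have n: "m + L \<le> n" "int (N + L) - int n = 1" using N by (auto simp: n_def)
  define h where "h s = (of_bool (stake K s \<in> W) :: real)" for s
  define f where "f w = (of_bool (w \<in> V) :: real)" for w
  have [measurable]: "h \<in> borel_measurable streams_of" unfolding h_def by measurable
  have *: "measure \<mu> (A \<inter> B) = (\<integral>x. h (sdrop n (hist 0 x)) * f (stake L (hist 0 x)) \<partial>\<mu>)"
  proof -
    let ?P = "\<lambda>s. stake K (sdrop n s) \<in> W \<and> stake L s \<in> V"
    have [measurable]: "Measurable.pred streams_of ?P" by measurable
    have "A \<inter> B = {x. ?P (hist (int (N + L)) x)}"
      unfolding A' B' sdrop_hist n(2) by auto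
    then have "measure \<mu> (A \<inter> B) = measure \<mu> {x. ?P (hist 0 x)}"
      by (simp only:) (rule measure_hist, measurable)
    also have "\<dots> = (\<integral>x. of_bool (?P (hist 0 x)) \<partial>\<mu>)"
      by (rule integral_of_bool[symmetric]) measurable
    finally show ?thesis by (simp only: h_def f_def of_bool_conj)
  qed
  have A'': "measure \<mu> A = (\<integral>x. h (hist 0 x) \<partial>\<mu>)"
    using measure_hist[of "\<lambda>s. stake K s \<in> W" 1] by (simp add: A' h_def integral_of_bool)
  have B'': "measure \<mu> B = (\<Sum>w\<in>words L. freq w * f w)"
    unfolding B' has_freq_cylinder[OF has_freq_\<mu>] f_def
    by (simp add: of_bool_def if_distrib sum.If_cases cong: if_cong)
  show ?thesis
    unfolding * A'' B'' using m n(1) by (intro decoupling) (auto simp: h_def f_def)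
qed

lemma mixing:
  assumes m: "forgets m c" "0 \<le> c" and N: "m < N"
    and A: "A \<in> sets (coord_algebra {..0})" and B: "B \<in> sets (coord_algebra {int N..})"
  shows "\<bar>measure \<mu> (A \<inter> B) - measure \<mu> A * measure \<mu> B\<bar> \<le> c * measure \<mu> A"
proof (rule field_le_epsilon)
  fix e :: real assume "0 < e"
  \<comment> \<open>passing to cylinders costs \<open>2 * d\<close> for the intersection, \<open>2 * d\<close> for the product and
    \<open>c * d\<close> on the right-hand side\<close>
  define d where "d = e / (4 + c)"
  have d: "0 < d" "(4 + c) * d = e" using \<open>0 < e\<close> m(2) by (auto simp: d_def)
  obtain C where C: "C \<in> cylinders (\<lambda>_. 1)" "C \<in> sets \<mu>" "measure \<mu> (sym_diff A C) < d"
    using cylinder_approx[OF window_system_past[of 1, simplified] A d(1)] .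
  obtain D where D: "D \<in> cylinders (\<lambda>L. int (N + L))" "D \<in> sets \<mu>" "measure \<mu> (sym_diff B D) < d"
    using cylinder_approx[OF window_system_future B d(1)] .
  have [measurable]: "A \<in> sets \<mu>" "B \<in> sets \<mu>" "C \<in> sets \<mu>" "D \<in> sets \<mu>"
    using A B C D coord_sets by auto
  have AC: "\<bar>measure \<mu> A - measure \<mu> C\<bar> \<le> d"
    using measure_diff_le_sym_diff[of A C] C(3) by simp
  have BD: "\<bar>measure \<mu> B - measure \<mu> D\<bar> \<le> d"
    using measure_diff_le_sym_diff[of B D] D(3) by simp
  have "measure \<mu> (sym_diff (A \<inter> B) (C \<inter> D)) \<le> measure \<mu> (sym_diff A C \<union> sym_diff B D)"
    by (intro finite_measure_mono) auto
  also have "\<dots> \<le> measure \<mu> (sym_diff A C) + measure \<mu> (sym_diff B D)"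
    by (intro measure_Un_le) auto
  finally have ABCD: "\<bar>measure \<mu> (A \<inter> B) - measure \<mu> (C \<inter> D)\<bar> \<le> 2 * d"
    using measure_diff_le_sym_diff[of "A \<inter> B" "C \<inter> D"] C(3) D(3) by simp
  have "\<bar>measure \<mu> C * measure \<mu> D - measure \<mu> A * measure \<mu> B\<bar>
      = \<bar>(measure \<mu> C - measure \<mu> A) * measure \<mu> D + measure \<mu> A * (measure \<mu> D - measure \<mu> B)\<bar>"
    by (simp add: algebra_simps)
  also have "\<dots> \<le> \<bar>measure \<mu> C - measure \<mu> A\<bar> * measure \<mu> D + measure \<mu> A * \<bar>measure \<mu> D - measure \<mu> B\<bar>"
    by (rule order_trans[OF abs_triangle_ineq]) (simp add: abs_mult)
  also have "\<dots> \<le> d * 1 + 1 * d"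
    using AC BD d(1) prob_le_1 by (intro add_mono mult_mono) (auto simp: abs_minus_commute)
  finally have prod: "\<bar>measure \<mu> C * measure \<mu> D - measure \<mu> A * measure \<mu> B\<bar> \<le> 2 * d" by simp
  have "c * measure \<mu> C \<le> c * (measure \<mu> A + d)"
    using AC m(2) by (intro mult_left_mono) auto
  then have "\<bar>measure \<mu> (C \<inter> D) - measure \<mu> C * measure \<mu> D\<bar> \<le> c * measure \<mu> A + c * d"
    using mixing_cylinders[OF m(1) N C(1) D(1)] by (simp add: algebra_simps)
  then show "\<bar>measure \<mu> (A \<inter> B) - measure \<mu> A * measure \<mu> B\<bar> \<le> c * measure \<mu> A + e"
    using ABCD prod d(2) by (simp add: algebra_simps)
qed

text \<open>Splitting the parts by the sign of the difference, the sum becomes the difference for two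
  single events of the future.\<close>

lemma mixing_partition:
  assumes m: "forgets m c" "0 \<le> c" and N: "m < N"
    and A: "A \<in> sets (coord_algebra {..0})"
    and Q: "finite Q" "disjoint Q" "Q \<subseteq> sets (coord_algebra {int N..})"
  shows "(\<Sum>B\<in>Q. \<bar>measure \<mu> (A \<inter> B) - measure \<mu> A * measure \<mu> B\<bar>) \<le> 2 * c * measure \<mu> A"
proof -
  let ?d = "\<lambda>B. measure \<mu> (A \<inter> B) - measure \<mu> A * measure \<mu> B"
  have part: "\<bar>\<Sum>B\<in>R. ?d B\<bar> \<le> c * measure \<mu> A" if "R \<subseteq> Q" for R
  proof -
    have "disjoint_family_on (\<lambda>B. B) R"
      unfolding disjoint_family_on_def using that disjointD[OF Q(2)] by blast
    then have R: "finite R" "R \<subseteq> sets (coord_algebra {int N..})" "disjoint_family_on (\<lambda>B. B) R"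
      using that Q(3) finite_subset[OF that Q(1)] by auto
    have sets: "A \<in> sets \<mu>" "\<And>B. B \<in> R \<Longrightarrow> B \<in> sets \<mu>" using A R(2) coord_sets by auto
    have "(\<Sum>B\<in>R. measure \<mu> B) = measure \<mu> (\<Union>B\<in>R. B)"
      using R sets by (intro finite_measure_finite_Union[symmetric]) auto
    moreover have "(\<Sum>B\<in>R. measure \<mu> (A \<inter> B)) = measure \<mu> (\<Union>B\<in>R. A \<inter> B)"
      using R sets by (intro finite_measure_finite_Union[symmetric]) (auto simp: disjoint_family_on_def)
    ultimately have "(\<Sum>B\<in>R. ?d B) = measure \<mu> (A \<inter> \<Union>R) - measure \<mu> A * measure \<mu> (\<Union>R)"
      by (simp only: sum_subtractf sum_distrib_left[symmetric] Int_UN_distrib[of A "\<lambda>B. B", symmetric] image_ident)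
    moreover have "\<Union>R \<in> sets (coord_algebra {int N..})" using R by (intro sets.finite_Union) auto
    ultimately show ?thesis using mixing[OF m N A] by simp
  qed
  let ?P = "{B \<in> Q. 0 \<le> ?d B}"
  have "(\<Sum>B\<in>Q. \<bar>?d B\<bar>) = (\<Sum>B\<in>?P. \<bar>?d B\<bar>) + (\<Sum>B\<in>Q - ?P. \<bar>?d B\<bar>)"
    using Q(1) by (subst sum.subset_diff[of ?P Q]) auto
  also have "(\<Sum>B\<in>?P. \<bar>?d B\<bar>) = (\<Sum>B\<in>?P. ?d B)" by (intro sum.cong) auto
  also have "(\<Sum>B\<in>Q - ?P. \<bar>?d B\<bar>) = - (\<Sum>B\<in>Q - ?P. ?d B)"
    unfolding sum_negf[symmetric] by (intro sum.cong) auto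
  finally show ?thesis using part[of ?P] part[of "Q - ?P"] by (simp add: abs_le_iff)
qed

lemma beta_mixing_coeff_le:
  assumes m: "forgets m c" "0 \<le> c" and N: "m < N"
  shows "0 \<le> beta_mixing_coeff \<mu> N \<and> beta_mixing_coeff \<mu> N \<le> c"
proof -
  let ?S = "{1/2 * (\<Sum>A\<in>P. \<Sum>B\<in>Q. \<bar>measure \<mu> (A \<inter> B) - measure \<mu> A * measure \<mu> B\<bar>) | P Q.
        finite P \<and> partition_on UNIV P \<and> P \<subseteq> sets (coord_algebra {..0}) \<and>
        finite Q \<and> partition_on UNIV Q \<and> Q \<subseteq> sets (coord_algebra {int N..})}"
  have le: "y \<le> c" if y: "y \<in> ?S" for y
  proof -
    obtain P Q where y: "y = 1/2 * (\<Sum>A\<in>P. \<Sum>B\<in>Q. \<bar>measure \<mu> (A \<inter> B) - measure \<mu> A * measure \<mu> B\<bar>)"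
      and P: "finite P" "partition_on UNIV P" "P \<subseteq> sets (coord_algebra {..0})"
      and Q: "finite Q" "partition_on UNIV Q" "Q \<subseteq> sets (coord_algebra {int N..})"
      using y by blast
    have "(\<Sum>A\<in>P. \<Sum>B\<in>Q. \<bar>measure \<mu> (A \<inter> B) - measure \<mu> A * measure \<mu> B\<bar>) \<le> (\<Sum>A\<in>P. 2 * c * measure \<mu> A)"
      using P Q partition_onD2[OF Q(2)] by (intro sum_mono mixing_partition[OF m N]) auto
    also have "\<dots> = 2 * c * (\<Sum>A\<in>P. measure \<mu> A)" by (simp add: sum_distrib_left)
    also have "(\<Sum>A\<in>P. measure \<mu> A) = measure \<mu> (\<Union>A\<in>P. A)"
      using P coord_sets partition_onD2[OF P(2)]
      by (intro finite_measure_finite_Union[symmetric]) (auto simp: disjoint_family_on_def disjoint_def)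
    also have "\<dots> \<le> 1" by (rule prob_le_1)
    finally show ?thesis using y m(2) by (simp add: mult_left_mono)
  qed
  have "0 \<in> ?S"
  proof -
    have top: "UNIV \<in> sets (coord_algebra I :: (int \<Rightarrow> 'a) measure)" for I
      using sets.top[of "coord_algebra I :: (int \<Rightarrow> 'a) measure"] by simp
    have "partition_on UNIV {UNIV :: (int \<Rightarrow> 'a) set}" by (simp add: partition_on_def)
    then show ?thesis
      using prob_space top by (intro CollectI exI[of _ "{UNIV}"]) auto
  qed
  moreover have "bdd_above ?S" using le by (rule bdd_aboveI)
  ultimately have "0 \<le> Sup ?S" by (rule cSup_upper)
  moreover have "Sup ?S \<le> c"
    using \<open>0 \<in> ?S\<close> by (intro cSup_least le) blast
  ultimately show ?thesis by (simp only: beta_mixing_coeff_def)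
qed

theorem weak_Bernoulli_\<mu>: "weak_Bernoulli \<mu>"
  unfolding weak_Bernoulli_def
proof (rule LIMSEQ_I)
  fix e :: real assume "0 < e"
  then obtain m where m: "forgets m (e / 2)" using uniform_forgetting[of "e / 2"] by auto
  have "norm (beta_mixing_coeff \<mu> N - 0) < e" if "Suc m \<le> N" for N
    using beta_mixing_coeff_le[OF m, of N] that \<open>0 < e\<close> by simp
  then show "\<exists>no. \<forall>n\<ge>no. norm (beta_mixing_coeff \<mu> n - 0) < e" by blast
qed

end

theorem (in chain) unique_compatible_weak_Bernoulli:
  "\<exists>\<mu>. {\<mu>. compatible \<mu>} = {\<mu>} \<and> weak_Bernoulli \<mu>"
proof -
  obtain \<mu> where \<mu>: "has_freq \<mu>" using exists_has_freq by blast
  interpret freq_process G \<epsilon> M \<mu>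
    using has_freq_process[OF \<mu>] \<mu> by (simp add: freq_process_def freq_process_axioms_def chain_axioms)
  have proc: "compatible_process G \<epsilon> M \<nu>" if "compatible \<nu>" for \<nu>
    using that chain_axioms
    by (auto simp: compatible_process_def compatible_process_axioms_def process_def process_axioms_def compatible_def)
  have "\<nu> = \<mu>" if "compatible \<nu>" for \<nu>
    using has_freq_unique[OF compatible_process.has_freq_\<mu>[OF proc[OF that]] \<mu>] .
  moreover have "compatible \<mu>" by (rule compatible_\<mu>)
  ultimately show ?thesis
    using compatible_process.weak_Bernoulli_\<mu>[OF proc] by (intro exI[of _ \<mu>]) blast
qed

section \<open>From \<open>g\<close>-functions to chains\<close>

definition to_past :: "'a stream \<Rightarrow> int \<Rightarrow> 'a" where
  "to_past s = (\<lambda>i\<in>{..-1}. s !! nat (- 1 - i))"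

text \<open>A \<open>g\<close>-function as a family of transition probabilities on pasts that are streams.\<close>

definition transition :: "((int \<Rightarrow> 'a) \<Rightarrow> real) \<Rightarrow> 'a stream \<Rightarrow> 'a \<Rightarrow> real" where
  "transition g s a = g ((to_past s)(0 := a))"

lemma to_past_in_pasts: "to_past s \<in> pasts"
  by (simp add: to_past_def seqs_def space_PiM)

lemma past_upd_in_space: "x \<in> pasts \<Longrightarrow> x(0 := a) \<in> space (seqs {..0})"
  by (auto simp: seqs_def space_PiM PiE_def extensional_def)

lemma transition_hist: "transition g (hist 0 x) a = g ((past x)(0 := a))"
proof -
  have "to_past (hist 0 x) = past x"
    by (auto simp: to_past_def past_def restrict_def)
  then show ?thesis by (simp add: transition_def)
qed

lemma transition_measurable:
  assumes "g \<in> borel_measurable (seqs {..0})"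
  shows "(\<lambda>s. transition g s a) \<in> borel_measurable streams_of"
proof -
  have "(\<lambda>s. (to_past s)(0 := a)) \<in> measurable streams_of (seqs {..0})"
    unfolding seqs_def
  proof (rule measurable_PiM_single')
    show "(\<lambda>s. ((to_past s)(0 := a)) i) \<in> measurable streams_of (count_space UNIV)" if "i \<in> {..0}" for i
    proof (cases "i = 0")
      case False
      then have "(\<lambda>s :: 'a stream. ((to_past s)(0 := a)) i) = (\<lambda>s. s !! nat (- 1 - i))"
        using that by (auto simp: to_past_def)
      then show ?thesis by simp
    qed simp
  qed (auto simp: to_past_def extensional_def split: if_splits)
  then show ?thesis
    unfolding transition_def by (rule measurable_compose) (rule assms)
qed

lemma append_suffix_to_past:
  assumes "k \<le> length w"
  shows "append_suffix (to_past (sdrop k (w @- t))) k (to_past (w @- s)) = to_past (w @- t)"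
proof
  fix i
  consider "i > -1" | "i \<le> -1" "- int k \<le> i" | "i < - int k" by linarith
  then show "append_suffix (to_past (sdrop k (w @- t))) k (to_past (w @- s)) i = to_past (w @- t) i"
  proof cases
    case 2
    then have "nat (- 1 - i) < length w" using assms by linarith
    then show ?thesis using 2 by (simp add: append_suffix_def to_past_def)
  next
    case 3
    then have "k + nat (- 1 - (i + int k)) = nat (- 1 - i)" by linarith
    then show ?thesis using 3 by (simp add: append_suffix_def to_past_def sdrop_snth)
  qed (auto simp: append_suffix_def to_past_def)
qed

text \<open>If the context of a past that ends in \<open>w\<close> were no longer than \<open>w\<close>, then \<open>g\<close> could not tell
  apart two pasts that share \<open>w\<close>.\<close>

lemma rev_undetermined_in_level:
  assumes "w \<in> undetermined (transition g) n"
  shows "rev w \<in> context_tree_level g n"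
proof -
  obtain s t a where n: "length w = n" and diff: "transition g (w @- s) a \<noteq> transition g (w @- t) a"
    using assms by (auto simp: undetermined_def words_def)
  let ?y = "to_past (w @- s)"
  have "map ?y [- int n..-1] = rev w"
    by (rule nth_equalityI) (auto simp: n to_past_def rev_nth nat_diff_distrib nat_add_distrib algebra_simps)
  moreover have "enat n < context_length g ?y"
  proof (rule ccontr)
    assume "\<not> enat n < context_length g ?y"
    then have "context_length g ?y < enat (Suc n)"
      by (simp add: not_less order_le_less_trans)
    then obtain k where "enat k < enat (Suc n)"
      and eq: "\<forall>a. \<forall>y\<in>pasts. \<forall>z\<in>pasts.
        g ((append_suffix y k ?y)(0 := a)) = g ((append_suffix z k ?y)(0 := a))"
      unfolding context_length_def Inf_less_iff by blast
    then have k: "k \<le> n" by simp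
    have "g ((append_suffix (to_past (sdrop k (w @- s))) k ?y)(0 := a))
        = g ((append_suffix (to_past (sdrop k (w @- t))) k ?y)(0 := a))"
      using eq to_past_in_pasts by blast
    then show False using diff k by (simp add: append_suffix_to_past n transition_def)
  qed
  ultimately show ?thesis
    unfolding context_tree_level_def using to_past_in_pasts by (metis (mono_tags, lifting) mem_Collect_eq)
qed

lemma card_undetermined_le: "card (undetermined (transition g) n) \<le> card (context_tree_level g n)"
proof -
  have "context_tree_level g n \<subseteq> words n"
    by (auto simp: context_tree_level_def words_def)
  then have "finite (context_tree_level g n)" by (rule finite_subset) simp
  then show ?thesis
    by (rule card_inj_on_le[rotated 2]) (auto intro: inj_onI rev_undetermined_in_level)
qed

text \<open>The root test.\<close>

lemma summable_of_upper_growth: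
  assumes growth: "upper_growth g < ereal (inverse M)" and M: "0 < M"
  shows "summable (\<lambda>n. real (card (undetermined (transition g) n)) * M ^ n)"
proof -
  obtain \<rho> where \<rho>: "upper_growth g < ereal \<rho>" "ereal \<rho> < ereal (inverse M)"
    using ereal_dense2[OF growth] by blast
  let ?c = "\<lambda>n. real (card (context_tree_level g n))"
  have ev: "\<forall>\<^sub>F n in sequentially. root n (?c n) < \<rho>"
    using Limsup_lessD[OF \<rho>(1)[unfolded upper_growth_def]] by simp
  have "\<rho> > 0"
  proof -
    obtain n where "root n (?c n) < \<rho>" using ev by (auto simp: eventually_sequentially)
    moreover have "0 \<le> root n (?c n)" by (cases "n = 0") (auto simp: real_root_ge_zero)
    ultimately show ?thesis by linarith
  qed
  have "\<forall>\<^sub>F n in sequentially. norm (real (card (undetermined (transition g) n)) * M ^ n) \<le> (\<rho> * M) ^ n"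
    using ev eventually_gt_at_top[of 0]
  proof eventually_elim
    case (elim n)
    have "real (card (undetermined (transition g) n)) \<le> ?c n"
      using card_undetermined_le[of g n] by simp
    also have "?c n = root n (?c n) ^ n" using elim by simp
    also have "\<dots> \<le> \<rho> ^ n" using elim by (intro power_mono) auto
    finally show ?case using M by (simp add: power_mult_distrib mult_right_mono)
  qed
  moreover have "summable (\<lambda>n. (\<rho> * M) ^ n)"
    using \<rho>(2) \<open>\<rho> > 0\<close> M by (intro summable_geometric) (simp add: field_simps)
  ultimately show ?thesis by (rule summable_comparison_test_ev)
qed

theorem corollary4:
  fixes g :: "(int \<Rightarrow> 'a::finite) \<Rightarrow> real" and \<epsilon> :: real
  assumes "g_function g"
    and "\<epsilon> > 0"
    and "\<And>z. z \<in> space (seqs {..0}) \<Longrightarrow> g z \<ge> \<epsilon>"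
    and "upper_growth g < ereal (inverse (1 - (real CARD('a) - 1) * \<epsilon>))"
  shows "\<exists>\<mu>. invariant_compatible g = {\<mu>} \<and> weak_Bernoulli \<mu>"
proof -
  define M where "M = 1 - (real CARD('a) - 1) * \<epsilon>"
  have ge: "\<epsilon> \<le> transition g s a" for s a
    unfolding transition_def by (intro assms(3) past_upd_in_space to_past_in_pasts)
  have sum: "(\<Sum>a\<in>UNIV. transition g s a) = 1" for s
    using assms(1) to_past_in_pasts[of s] by (auto simp: g_function_def transition_def)
  have "0 < M"
  proof -
    have "(\<Sum>a\<in>(UNIV :: 'a set). \<epsilon>) \<le> (\<Sum>a\<in>UNIV. transition g (sconst undefined) a)"
      by (intro sum_mono ge)
    then have "real CARD('a) * \<epsilon> \<le> 1" using sum by simp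
    then show ?thesis using \<open>\<epsilon> > 0\<close> by (simp add: M_def algebra_simps)
  qed
  then have "summable (\<lambda>n. real (card (undetermined (transition g) n)) * M ^ n)"
    using assms(4) by (intro summable_of_upper_growth) (simp_all add: M_def)
  moreover have "g \<in> borel_measurable (seqs {..0})" using assms(1) by (simp add: g_function_def)
  ultimately interpret chain "transition g" \<epsilon> M
    using \<open>\<epsilon> > 0\<close> ge sum by unfold_locales (auto intro: transition_measurable simp: M_def)
  have "invariant_compatible g = {\<mu>. compatible \<mu>}"
    by (simp add: invariant_compatible_def compatible_def transition_hist)
  then show ?thesis using unique_compatible_weak_Bernoulli by simp
qed

end
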